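(* There exists a constant $\kappa>0$ such that for all sufficiently large $n$, any round $m\ge0$ and any function $f(n)\ge0$, the Relative-Threshold$(f(n))$ process satisfies $$\Pr\big[\mathrm{Gap}(m)\le\kappa(\log n+f(n))\big]\ge1-n^{-4}.$$
   Context: Relative-Threshold$(f(n))$ process on $n$ bins, with offset $f(n)\ge0$: start with the empty load vector $x^0=(0,\dots,0)$. In each round $t\ge0$ sample two bins $i_1,i_2\in[n]$ independently and uniformly at random; allocate one ball to $i_1$ if $x_{i_1}^t<\frac tn+f(n)$, and one ball to $i_2$ if $x_{i_1}^t\ge\frac tn+f(n)$. Here $x^t$ is the load vector after $t$ rounds and $\mathrm{Gap}(t)=\max_{i\in[n]}x_i^t-\frac tn$. *)

theory Defs
  imports "HOL-Probability.Probability"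
begin

text \<open>
  The bins are \<open>{1..n}\<close>; a load vector is a function \<open>nat \<Rightarrow> nat\<close>, of which only the
  values on \<open>{1..n}\<close> matter. The definitions are meant for \<open>n \<ge> 1\<close>: for \<open>n = 0\<close> the
  uniform distribution on the empty set is an unspecified value.
\<close>

definition add_ball :: "nat \<Rightarrow> (nat \<Rightarrow> nat) \<Rightarrow> nat \<Rightarrow> nat" where
  "add_ball i x = x(i := Suc (x i))"

definition rel_threshold_step :: "nat \<Rightarrow> real \<Rightarrow> nat \<Rightarrow> (nat \<Rightarrow> nat) \<Rightarrow> (nat \<Rightarrow> nat) pmf" where
  "rel_threshold_step n c t x =
     bind_pmf (pmf_of_set {1..n}) (\<lambda>i1.
     bind_pmf (pmf_of_set {1..n}) (\<lambda>i2.
       return_pmf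
         (if real (x i1) < real t / real n + c then add_ball i1 x else add_ball i2 x)))"

text \<open>
  \<open>rel_threshold n c t\<close> is the law of the load vector after \<open>t\<close> rounds of the process on
  \<open>n\<close> bins with offset \<open>c\<close>. Rounds are numbered from 0, so the step leading from time
  \<open>t\<close> to \<open>t + 1\<close> compares with the average load \<open>t / n\<close>.
\<close>

primrec rel_threshold :: "nat \<Rightarrow> real \<Rightarrow> nat \<Rightarrow> (nat \<Rightarrow> nat) pmf" where
  "rel_threshold n c 0 = return_pmf (\<lambda>_. 0)"
| "rel_threshold n c (Suc t) = bind_pmf (rel_threshold n c t) (rel_threshold_step n c t)"

definition gap :: "nat \<Rightarrow> nat \<Rightarrow> (nat \<Rightarrow> nat) \<Rightarrow> real" where
  "gap n t x = real (Max (x ` {1..n})) - real t / real n"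

end

theory Submission
  imports Defs "HOL-Real_Asymp.Real_Asymp"
begin

text \<open>
  Write \<open>y\<close> for the vector of loads minus the average, \<open>f\<close> for the offset, and call a bin heavy if
  \<open>y i \<ge> f\<close>, light otherwise. With a rate \<open>g\<close> of order \<open>1 / (1 + f)\<close>, the product of
  \<open>\<Sum>i. exp (g * y i)\<close> and \<open>\<Sum>i. exp (- g * y i)\<close> has a first order drift proportional to the share of
  the heavy bins in the second sum minus their share in the first one, which is never positive.
  It is negative as soon as the product is large, unless nearly all bins are on the same side of the
  threshold; in that case a correction factor built from a convex function of the loads decreases.
  So this potential has a polynomially bounded mean, and all differences of loads are
  \<open>O((1 + f) * ln n)\<close> with high probability.
  This proves the theorem for \<open>f \<le> 1\<close>.

  For \<open>1 \<le> f \<le> n\<^sup>2\<close>, take a smaller rate. Then one ball changes the potential so little that it is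
  bounded by a constant with high probability during a polynomial number of rounds. For
  \<open>f \<ge> 1\<close> this excludes that nearly all bins are heavy, hence
  \<open>\<Sum>i. exp (a * (y i - f))\<close> contracts for a constant \<open>a\<close>, and the gap is at most \<open>f + O(ln n)\<close>.
\<close>

subsection \<open>Huber functions\<close>

text \<open>The spread bound only gives a gap of order \<open>(1 + f) * ln n\<close>, which is too
  weak by a logarithm when \<open>f\<close> is large. The second stage therefore needs a rate
  \<open>a\<close> independent of \<open>f\<close>, hence a constant share of light bins.
  \<open>light_frac_ge\<close> extracts this share from a bounded pair potential, but only if
  \<open>g * f\<close> is bounded below, while the degenerate case needs \<open>g * f\<close> small.
  For \<open>f \<ge> 1\<close> this fixes the order \<open>1 / (1 + f)\<close> of the rate.

  The number of rounds is arbitrary, so no union bound over the whole past is available. The spread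
  is controlled at each fixed time through a mean. The two later tail bounds look back over
  \<open>n ^ 7\<close> rounds only: the previous bound controls the start of this window and the
  failures inside it, and the contraction erases the starting value.

  The prefactor of the spread tail contains \<open>1 / g\<close>, which is polynomial in
  \<open>n\<close> only if \<open>f\<close> is. Hence offsets above \<open>n\<^sup>2\<close> are
  treated separately, where an extra term of order \<open>n * ln n\<close> in the gap is
  affordable.\<close>

definition clamp1 :: "real \<Rightarrow> real \<Rightarrow> real" where
  "clamp1 R u = max (- R) (min R u)"

text \<open>This is half the square on \<open>[- R, R]\<close>, continued linearly with slopes
  \<open>- R\<close> and \<open>R\<close>. For \<open>R \<ge> 0\<close> it is the maximum of
  \<open>v * u - v\<^sup>2 / 2\<close> over \<open>\<bar>v\<bar> \<le> R\<close>, attained at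
  \<open>v = clamp1 R u\<close>; convexity and the Lipschitz bound are read off this form.\<close>

definition huber :: "real \<Rightarrow> real \<Rightarrow> real" where
  "huber R u = clamp1 R u * u - (clamp1 R u)\<^sup>2 / 2"

lemma abs_clamp1_le: "R \<ge> 0 \<Longrightarrow> \<bar>clamp1 R u\<bar> \<le> R"
  by (auto simp: clamp1_def)

text \<open>With \<open>c = clamp1 R u\<close> the difference of the two sides factors as
  \<open>(c - v) * (u - (c + v) / 2)\<close>. The factors have the same sign, since a clamped
  \<open>c\<close> is the end of the interval on the side of \<open>u\<close>.\<close>

lemma huber_ge_affine:
  assumes "\<bar>v\<bar> \<le> R"
  shows "v * u - v\<^sup>2 / 2 \<le> huber R u"
proof -
  have *: "(c - v) * (u - (c + v) / 2) \<ge> 0 \<Longrightarrow> v * u - v\<^sup>2 / 2 \<le> c * u - c\<^sup>2 / 2" for c :: real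
    by (simp add: field_simps power2_eq_square)
  show ?thesis
    unfolding huber_def
  proof (rule *)
    consider "u < - R" | "u > R" | "\<bar>u\<bar> \<le> R" by linarith
    then show "(clamp1 R u - v) * (u - (clamp1 R u + v) / 2) \<ge> 0"
    proof cases
      case 1
      then have "clamp1 R u = - R" using assms by (auto simp: clamp1_def)
      with 1 assms show ?thesis
        by (intro mult_nonpos_nonpos) (auto simp: abs_if split: if_splits)
    next
      case 2
      then have "clamp1 R u = R" using assms by (auto simp: clamp1_def)
      with 2 assms show ?thesis
        by (intro mult_nonneg_nonneg) (auto simp: abs_if field_simps split: if_splits)
    next
      case 3
      then have "clamp1 R u = u" by (auto simp: clamp1_def)
      moreover have "(u - v) * (u - (u + v) / 2) = (u - v)\<^sup>2 / 2"
        by (simp add: field_simps power2_eq_square)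
      ultimately show ?thesis by (metis zero_le_power2 divide_nonneg_nonneg zero_le_numeral)
    qed
  qed
qed

lemma huber_nonneg: "R \<ge> 0 \<Longrightarrow> huber R u \<ge> 0"
  using huber_ge_affine[of 0 R u] by simp

lemma huber_le: 
  assumes "R \<ge> 0"
  shows "huber R u \<le> R * \<bar>u\<bar>"
proof -
  have "clamp1 R u * u \<le> \<bar>clamp1 R u\<bar> * \<bar>u\<bar>" 
    by (metis abs_ge_self abs_mult)
  also have "\<dots> \<le> R * \<bar>u\<bar>" using abs_clamp1_le[OF assms] by (intro mult_right_mono) auto
  finally show ?thesis unfolding huber_def by (smt (verit) zero_le_power2 divide_nonneg_nonneg)
qed

lemma huber_convex: 
  assumes "R \<ge> 0"
  shows "huber R u + clamp1 R u * h \<le> huber R (u + h)"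
  using huber_ge_affine[OF abs_clamp1_le[OF assms], of u "u + h"]
  by (simp add: huber_def algebra_simps)

lemma huber_lipschitz:
  assumes "R \<ge> 0"
  shows "\<bar>huber R (u + h) - huber R u\<bar> \<le> R * \<bar>h\<bar>"
proof -
  have b: "\<bar>clamp1 R v * h\<bar> \<le> R * \<bar>h\<bar>" for v
    unfolding abs_mult using abs_clamp1_le[OF assms] by (intro mult_right_mono) auto
  show ?thesis
    using huber_convex[OF assms, of u h] huber_convex[OF assms, of "u + h" "- h"] b[of u] b[of "u + h"]
    by (simp add: abs_le_iff) 
qed

lemma huber_strongly_convex:
  assumes "\<bar>u\<bar> \<le> R" "\<bar>u + h\<bar> \<le> R"
  shows "huber R (u + h) = huber R u + clamp1 R u * h + h\<^sup>2 / 2"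
proof -
  have "clamp1 R u = u" "clamp1 R (u + h) = u + h" using assms by (auto simp: clamp1_def)
  then show ?thesis by (simp add: huber_def field_simps power2_eq_square)
qed

subsection \<open>The drift of the product potential\<close>

text \<open>In the application of this and the next two inequalities, \<open>\<delta>\<close> and
  \<open>\<eta>\<close> are the shares of heavy and light bins, \<open>a\<close> and
  \<open>b\<close> the heavy and light parts of the average of \<open>exp (g * (y i - f))\<close>,
  and \<open>c\<close> and \<open>d\<close> those of the average of
  \<open>exp (- g * (y i - f))\<close>. The hypotheses hold because each term is on the expected
  side of 1.\<close>

lemma mult_diff_nonneg:
  fixes a b c d \<delta> \<eta> :: real
  assumes "0 \<le> b" "b \<le> \<eta>" "\<delta> \<le> a" "0 \<le> c" "c \<le> \<delta>" "\<eta> \<le> d" 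
  shows "b * c \<le> \<delta> * \<eta>" "\<delta> * \<eta> \<le> a * d"
  using assms mult_mono[of b \<eta> c \<delta>] mult_mono[of \<delta> a \<eta> d] by (auto simp: mult.commute)

text \<open>Only \<open>b * c\<close> counts against the drift, and it is at most
  \<open>\<delta> * \<eta> \<le> 1/4\<close>. A product of 25 forces \<open>a \<ge> 4\<close> or
  \<open>d \<ge> 4\<close>, as otherwise it is at most 16 + 1/4 + 4; then \<open>a * d\<close> is at
  least four times \<open>b * c\<close>. The factor \<open>min \<delta> \<eta>\<close> lets
  \<open>a * d\<close> absorb the cross terms \<open>a * c\<close> and \<open>b * d\<close>.\<close>

lemma mult_diff_large:
  fixes a b c d \<delta> \<eta> :: real
  assumes "0 \<le> b" "b \<le> \<eta>" "\<delta> \<le> a" "0 \<le> c" "c \<le> \<delta>" "\<eta> \<le> d" "\<delta> + \<eta> = 1"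
    and big: "25 \<le> (a + b) * (c + d)"
  shows "min \<delta> \<eta> * ((a + b) * (c + d)) \<le> 8 * (a * d - b * c)"
proof -
  have nn: "0 \<le> \<delta>" "0 \<le> \<eta>" using assms by linarith+
  have q: "\<delta> * \<eta> \<le> 1/4"
  proof -
    have "4 * (\<delta> * \<eta>) = (\<delta> + \<eta>)\<^sup>2 - (\<delta> - \<eta>)\<^sup>2" by (simp add: power2_eq_square algebra_simps)
    moreover have "(\<delta> - \<eta>)\<^sup>2 \<ge> 0" "(\<delta> + \<eta>)\<^sup>2 = 1" using assms(7) by simp_all
    ultimately show ?thesis by linarith
  qed
  have bc: "b * c \<le> \<delta> * \<eta>" and ad0: "\<delta> * \<eta> \<le> a * d"
    using mult_diff_nonneg[OF assms(1-6)] by simp_all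
  have ac: "a * c \<le> a * \<delta>" and bd: "b * d \<le> \<eta> * d"
    using assms nn by (auto intro!: mult_left_mono mult_right_mono)
  have four: "4 * (\<delta> * \<eta>) \<le> a * d"
  proof (cases "a \<ge> 4 \<or> d \<ge> 4")
    case True
    then show ?thesis
    proof
      assume "a \<ge> 4"
      then have "(4 * \<delta>) * \<eta> \<le> a * d" using assms nn by (intro mult_mono) auto
      then show ?thesis by simp
    next
      assume "d \<ge> 4"
      then have "\<delta> * (4 * \<eta>) \<le> a * d" using assms nn by (intro mult_mono) auto
      then show ?thesis by simp
    qed
  next
    case False
    have "a * d \<le> 4 * 4" using False assms nn by (intro mult_mono) auto
    moreover have "a * \<delta> \<le> 4 * \<delta>" "\<eta> * d \<le> \<eta> * 4" using False assms nn by (auto intro!: mult_mono)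
    moreover have "(a + b) * (c + d) = a * d + b * c + a * c + b * d" by (simp add: algebra_simps)
    ultimately have False using big bc q ac bd assms(7) by linarith
    then show ?thesis ..
  qed
  have ad_nn: "0 \<le> a * d" using ad0 nn by (meson mult_nonneg_nonneg order_trans)
  define m where "m = min \<delta> \<eta>"
  have m0: "m \<le> \<delta>" "m \<le> \<eta>" by (auto simp: m_def)
  have m: "0 \<le> m" "m \<le> 1/2" using nn assms(7) by (auto simp: m_def min_def)
  have "m * (a * d) \<le> a * d / 2" using mult_right_mono[OF m(2) ad_nn] by simp
  moreover have "m * (b * c) \<le> b * c / 2" using mult_right_mono[OF m(2), of "b * c"] assms by simp
  moreover have "m * (a * c) \<le> a * d"
  proof -
    have "m * (a * c) \<le> \<eta> * (a * 1)" using assms nn m m0 by (intro mult_mono mult_nonneg_nonneg) auto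
    also have "\<dots> = a * \<eta>" by simp
    also have "\<dots> \<le> a * d" using assms nn by (intro mult_left_mono) auto
    finally show ?thesis .
  qed
  moreover have "m * (b * d) \<le> a * d"
  proof -
    have "m * (b * d) \<le> \<delta> * (1 * d)" using assms nn m m0 by (intro mult_mono mult_nonneg_nonneg) auto
    also have "\<dots> \<le> a * d" using assms nn by (simp add: mult_right_mono)
    finally show ?thesis .
  qed
  moreover have "m * ((a + b) * (c + d)) = m * (a * d) + m * (b * c) + m * (a * c) + m * (b * d)"
    by (simp add: algebra_simps)
  moreover have "p \<le> A / 2 \<Longrightarrow> q \<le> B / 2 \<Longrightarrow> r \<le> A \<Longrightarrow> s \<le> A \<Longrightarrow> 4 * B \<le> A \<Longrightarrow> 0 \<le> A
      \<Longrightarrow> p + q + r + s \<le> 8 * A - 8 * B" for p q r s A B :: real by linarith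
  moreover have "4 * (b * c) \<le> a * d" using four bc by linarith
  ultimately have "m * ((a + b) * (c + d)) \<le> 8 * (a * d) - 8 * (b * c)"
    using ad_nn by presburger
  then show ?thesis by (simp add: m_def right_diff_distrib)
qed

text \<open>This serves the case of few light bins that are far below the threshold. The drift is
  then of constant order, without the factor \<open>min \<delta> \<eta>\<close>, which would be too
  small.\<close>

lemma mult_diff_far:
  fixes a b c d \<delta> \<eta> :: real
  assumes "0 \<le> b" "b \<le> \<eta>" "\<delta> \<le> a" "0 \<le> c" "c \<le> \<delta>" "\<eta> \<le> d" "\<delta> + \<eta> = 1" "1/2 \<le> \<delta>" "4 \<le> d"
  shows "(a + b) * (c + d) \<le> 8 * (a * d - b * c)"
proof -
  have nn: "0 \<le> \<delta>" "0 \<le> \<eta>" using assms by linarith+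
  have "b * c \<le> (1/2) * 1" using assms nn by (intro mult_mono) auto
  moreover have "a * c \<le> a * (d / 4)" using assms nn by (intro mult_left_mono) auto
  moreover have "b * d \<le> a * d" using assms nn by (intro mult_right_mono) auto
  moreover have "(1/2) * 4 \<le> a * d" using assms nn by (intro mult_mono) auto
  moreover have "(a + b) * (c + d) = a * d + b * c + a * c + b * d" by (simp add: algebra_simps)
  ultimately show ?thesis by auto
qed

definition expsum :: "real \<Rightarrow> 'a set \<Rightarrow> ('a \<Rightarrow> real) \<Rightarrow> real" where
  "expsum g I y = (\<Sum>i\<in>I. exp (g * y i))"

text \<open>
  The product of the two exponential sums does not change when a constant is added to all
  entries of \<open>y\<close>; it is the minimum over \<open>u\<close> of the squared sum of \<open>cosh (g * (y i - u))\<close>.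
\<close>

definition pairpot :: "real \<Rightarrow> 'a set \<Rightarrow> ('a \<Rightarrow> real) \<Rightarrow> real" where
  "pairpot g I y = expsum g I y * expsum (- g) I y / (real (card I))\<^sup>2"

text \<open>
  When almost all bins lie on the same side of the threshold, the first order drift of
  \<open>pairpot\<close> vanishes. The typical bin is then close to an unbiased random walk, so a convex
  function of its load grows; this factor turns that growth into a decrease of the potential.
\<close>

definition smoothing :: "real \<Rightarrow> 'a set \<Rightarrow> ('a \<Rightarrow> real) \<Rightarrow> real" where
  "smoothing g I y = exp (- (256 * g\<^sup>2 / real (card I) * (\<Sum>i\<in>I. huber (1 / (8192 * g)) (y i))))"

definition potential :: "real \<Rightarrow> 'a set \<Rightarrow> ('a \<Rightarrow> real) \<Rightarrow> real" where
  "potential g I y = pairpot g I y * smoothing g I y"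

definition move :: "'a set \<Rightarrow> 'a \<Rightarrow> ('a \<Rightarrow> real) \<Rightarrow> 'a \<Rightarrow> real" where
  "move I i y = (\<lambda>j. y j - 1 / real (card I) + (if j = i then 1 else 0))"

definition heavy_frac :: "real \<Rightarrow> 'a set \<Rightarrow> ('a \<Rightarrow> real) \<Rightarrow> real" where
  "heavy_frac f I y = real (card {i \<in> I. f \<le> y i}) / real (card I)"

text \<open>Bin \<open>i\<close> receives the ball if it is the first sample and light, or if the
  first sample is heavy and the second one is \<open>i\<close>.\<close>

definition bin_prob :: "real \<Rightarrow> 'a set \<Rightarrow> ('a \<Rightarrow> real) \<Rightarrow> 'a \<Rightarrow> real" where
  "bin_prob f I y i = (heavy_frac f I y + (if y i < f then 1 else 0)) / real (card I)"

lemma exp_minus_le_quadratic: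
  fixes w :: real
  assumes "\<bar>w\<bar> \<le> 1/2"
  shows "exp (- w) \<le> 1 - w + w\<^sup>2"
proof (cases "w \<le> 0")
  case True
  then show ?thesis using exp_bound[of "- w"] assms by simp
next
  case False
  then have "exp (- w) \<le> 1 / (1 + w)"
    using exp_ge_add_one_self[of w] by (simp add: exp_minus field_simps)
  also have "\<dots> \<le> 1 - w + w\<^sup>2"
  proof -
    have "(1 - w + w\<^sup>2) * (1 + w) = 1 + w ^ 3" by (simp add: algebra_simps power2_eq_square power3_eq_cube)
    moreover have "w ^ 3 \<ge> 0" using False by simp
    ultimately show ?thesis using False by (simp add: divide_le_eq)
  qed
  finally show ?thesis .
qed

text \<open>
  Here \<open>y i\<close> is the load of bin \<open>i\<close> minus the average load, and \<open>f\<close> is the offset of the threshold.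
\<close>

locale balanced =
  fixes I :: "'a set" and y :: "'a \<Rightarrow> real" and f g n :: real
  assumes fin: "finite I" and n: "n = real (card I)" and n2: "n \<ge> 2"
    and sum0: "sum y I = 0" and f: "f \<ge> 0" and g: "g > 0" "g \<le> 1 / 2 ^ 46" "g * f \<le> 1 / 2 ^ 46"
begin

definition "heavy = {i \<in> I. f \<le> y i}"
definition "light = {i \<in> I. y i < f}"
definition "\<delta> = heavy_frac f I y"
definition "\<eta> = 1 - \<delta>"
abbreviation "p \<equiv> bin_prob f I y"
abbreviation "R \<equiv> 1 / (8192 * g)"
definition "\<alpha> i = exp (g * y i) / expsum g I y"
definition "\<beta> i = exp (- g * y i) / expsum (- g) I y"
definition "w i = 256 * g\<^sup>2 / n * (\<Sum>j\<in>I. huber R (move I i y j) - huber R (y j))"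
definition "D = (\<Sum>i\<in>heavy. \<alpha> i) - (\<Sum>i\<in>heavy. \<beta> i)"
definition "ratio i = (1 + (exp g - 1) * \<alpha> i) * (1 - (1 - exp (- g)) * \<beta> i) * exp (- w i)"
definition "heavy_weight = (\<Sum>i\<in>heavy. exp (g * (y i - f))) / n"
definition "light_weight = (\<Sum>i\<in>light. exp (- g * (y i - f))) / n"

section \<open>Probabilities of the bins and the effect of one ball on the potential\<close>

lemma npos: "n > 0" using n2 by simp
lemma ne: "I \<noteq> {}" using n2 n by auto

lemma g_small: "g < 1/1000000" using g(2) by simp

lemma parts: "heavy \<union> light = I" "heavy \<inter> light = {}" "finite heavy" "finite light"
  using fin by (auto simp: heavy_def light_def)

lemma sum_parts: "sum h I = sum h heavy + sum h light" for h :: "'a \<Rightarrow> real"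
  using parts sum.union_disjoint by metis

lemma card_parts: "real (card heavy) = \<delta> * n" "real (card light) = \<eta> * n"
proof -
  show 1: "real (card heavy) = \<delta> * n"
    using npos by (simp add: \<delta>_def heavy_frac_def heavy_def n)
  have "real (card I) = real (card heavy) + real (card light)"
    using sum_parts[of "\<lambda>_. 1"] by simp
  then show "real (card light) = \<eta> * n" using 1 n by (simp add: \<eta>_def algebra_simps)
qed

lemma frac: "0 \<le> \<delta>" "0 \<le> \<eta>" "\<delta> + \<eta> = 1"
proof -
  have "0 \<le> \<delta> * n" "0 \<le> \<eta> * n" using card_parts by (metis of_nat_0_le_iff)+
  then show "0 \<le> \<delta>" "0 \<le> \<eta>" using npos by (auto simp: zero_le_mult_iff)
qed (simp add: \<eta>_def)

lemma sum_p: "(\<Sum>i\<in>I. p i * h i) = (\<delta> * sum h I + sum h light) / n"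
proof -
  have "p i * h i = \<delta> * h i / n + (if y i < f then h i / n else 0)" for i
    by (simp add: bin_prob_def \<delta>_def n add_divide_distrib algebra_simps)
  then have "(\<Sum>i\<in>I. p i * h i) = (\<Sum>i\<in>I. \<delta> * h i / n) + (\<Sum>i\<in>I. if y i < f then h i / n else 0)"
    by (simp add: sum.distrib)
  also have "(\<Sum>i\<in>I. if y i < f then h i / n else 0) = (\<Sum>i\<in>light. h i / n)"
    unfolding light_def using fin by (simp add: sum.inter_filter)
  finally show ?thesis
    by (simp add: sum_divide_distrib sum_distrib_left add_divide_distrib)
qed

lemma p_nonneg: "0 \<le> p i" and p_heavy: "\<delta> / n \<le> p i"
  using frac npos by (auto simp: bin_prob_def \<delta>_def[symmetric] n[symmetric] divide_right_mono)

lemma p_light: "i \<in> light \<Longrightarrow> 1 / n \<le> p i"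
  using frac npos by (auto simp: light_def bin_prob_def \<delta>_def[symmetric] n[symmetric] divide_right_mono)

lemma sum_p_1: "(\<Sum>i\<in>I. p i) = 1"
proof -
  have "(\<Sum>i\<in>I. p i) = (\<delta> * n + \<eta> * n) / n"
    using sum_p[of "\<lambda>_. 1"] card_parts(2) by (simp add: n[symmetric])
  then show ?thesis using npos frac by (simp add: distrib_right[symmetric])
qed

lemma sum_p_const: "(\<Sum>i\<in>I. p i * c) = c"
  using sum_p_1 by (simp flip: sum_distrib_right)

lemma expsum_pos: "expsum c I h > 0"
  unfolding expsum_def using fin ne by (intro sum_pos) auto

lemma expsum_move:
  assumes "i \<in> I"
  shows "expsum c I (move I i y) = exp (- c / n) * (expsum c I y + (exp c - 1) * exp (c * y i))"
proof -
  have "exp (c * move I i y j) = exp (- c / n) * (exp (c * y j) + (if j = i then (exp c - 1) * exp (c * y j) else 0))" for j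
    by (auto simp: move_def n[symmetric] algebra_simps simp flip: exp_add)
  then have "expsum c I (move I i y)
      = (\<Sum>j\<in>I. exp (- c / n) * (exp (c * y j) + (if j = i then (exp c - 1) * exp (c * y j) else 0)))"
    by (simp add: expsum_def)
  also have "\<dots> = exp (- c / n) * (expsum c I y + (exp c - 1) * exp (c * y i))"
    using fin assms by (simp add: expsum_def sum.distrib sum_distrib_left[symmetric] sum.delta)
  finally show ?thesis .
qed

lemma pairpot_pos: "pairpot g I y > 0"
  using expsum_pos npos by (simp add: pairpot_def n[symmetric])

lemma potential_pos: "potential g I y > 0"
  using pairpot_pos by (simp add: potential_def smoothing_def)

text \<open>The factors \<open>exp (- g / n)\<close> and \<open>exp (g / n)\<close> caused by
  recentering cancel, so only the shares \<open>\<alpha> i\<close> and \<open>\<beta> i\<close> of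
  the chosen bin in the two sums enter.\<close>

lemma pairpot_move:
  assumes "i \<in> I"
  shows "pairpot g I (move I i y) =
    pairpot g I y * ((1 + (exp g - 1) * \<alpha> i) * (1 - (1 - exp (- g)) * \<beta> i))"
proof -
  have e: "expsum c I y + (exp c - 1) * exp (c * y i)
      = expsum c I y * (1 + (exp c - 1) * (exp (c * y i) / expsum c I y))" for c
    using expsum_pos[of c y] by (simp add: field_simps)
  have 1: "expsum g I (move I i y) = exp (- g / n) * (expsum g I y * (1 + (exp g - 1) * \<alpha> i))"
    unfolding expsum_move[OF assms] e \<alpha>_def ..
  have 2: "expsum (- g) I (move I i y) = exp (g / n) * (expsum (- g) I y * (1 + (exp (- g) - 1) * \<beta> i))"
    unfolding expsum_move[OF assms] e \<beta>_def by simp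
  have "exp (- g / n) * exp (g / n) = 1" by (simp flip: exp_add)
  moreover have "(u * (E * A)) * (v * (F * B)) = (u * v) * (E * F * (A * B))" for u v E F A B :: real
    by (simp only: mult_ac)
  ultimately have "expsum g I (move I i y) * expsum (- g) I (move I i y)
      = expsum g I y * expsum (- g) I y * ((1 + (exp g - 1) * \<alpha> i) * (1 + (exp (- g) - 1) * \<beta> i))"
    unfolding 1 2 by simp
  moreover have "1 + (exp (- g) - 1) * \<beta> i = 1 - (1 - exp (- g)) * \<beta> i" by (simp add: algebra_simps)
  ultimately show ?thesis unfolding pairpot_def by simp
qed

lemma smoothing_move: "smoothing g I (move I i y) = smoothing g I y * exp (- w i)"
proof -
  have "256 * g\<^sup>2 / n * (\<Sum>j\<in>I. huber R (move I i y j)) = 256 * g\<^sup>2 / n * (\<Sum>j\<in>I. huber R (y j)) + w i"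
    by (simp only: w_def sum_subtractf right_diff_distrib add_diff_cancel_left' add_diff_eq)
  then show ?thesis
    unfolding smoothing_def n[symmetric] by (simp flip: exp_add)
qed

lemma potential_move: "i \<in> I \<Longrightarrow> potential g I (move I i y) = potential g I y * ratio i"
  by (simp add: potential_def pairpot_move smoothing_move ratio_def)

section \<open>The first order drift of the pair potential\<close>

lemma shares: "0 < \<alpha> i" "0 < \<beta> i" "(\<Sum>i\<in>I. \<alpha> i) = 1" "(\<Sum>i\<in>I. \<beta> i) = 1"
  using expsum_pos[of g y] expsum_pos[of "- g" y]
  by (auto simp: \<alpha>_def \<beta>_def sum_divide_distrib[symmetric] expsum_def)

lemma share_le_1: "i \<in> I \<Longrightarrow> \<alpha> i \<le> 1" "i \<in> I \<Longrightarrow> \<beta> i \<le> 1"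
  using shares(1,2) fin shares(3,4) member_le_sum[of i I \<alpha>] member_le_sum[of i I \<beta>]
  by (auto intro: less_imp_le)

lemma heavy_share: "0 \<le> (\<Sum>i\<in>heavy. \<alpha> i)" "(\<Sum>i\<in>heavy. \<alpha> i) \<le> 1" "0 \<le> (\<Sum>i\<in>heavy. \<beta> i)" "(\<Sum>i\<in>heavy. \<beta> i) \<le> 1"
proof -
  have "0 \<le> (\<Sum>i\<in>J. \<alpha> i)" "0 \<le> (\<Sum>i\<in>J. \<beta> i)" for J
    by (auto intro!: sum_nonneg less_imp_le[OF shares(1)] less_imp_le[OF shares(2)])
  then show "0 \<le> (\<Sum>i\<in>heavy. \<alpha> i)" "(\<Sum>i\<in>heavy. \<alpha> i) \<le> 1" "0 \<le> (\<Sum>i\<in>heavy. \<beta> i)" "(\<Sum>i\<in>heavy. \<beta> i) \<le> 1"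
    using shares(3,4) sum_parts[of \<alpha>] sum_parts[of \<beta>] by smt+
qed

text \<open>Measuring loads from the threshold multiplies the two sums by inverse constants, so
  \<open>D\<close> becomes \<open>(a * d - b * c) / ((a + b) * (c + d))\<close>, whose denominator
  is the pair potential. The three product inequalities then apply.\<close>

lemma D_bounds:
  shows D_nonneg: "0 \<le> D"
    and D_large: "25 \<le> pairpot g I y \<Longrightarrow> min \<delta> \<eta> \<le> 8 * D"
    and D_far1: "1/2 \<le> \<delta> \<Longrightarrow> 4 \<le> light_weight \<Longrightarrow> 1 \<le> 8 * D"
    and D_far2: "1/2 \<le> \<eta> \<Longrightarrow> 4 \<le> heavy_weight \<Longrightarrow> 1 \<le> 8 * D"
proof -
  define a where "a = heavy_weight"
  define b where "b = (\<Sum>i\<in>light. exp (g * (y i - f))) / n"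
  define c where "c = (\<Sum>i\<in>heavy. exp (- g * (y i - f))) / n"
  define d where "d = light_weight"
  have card_le: "(\<forall>i\<in>J. h i \<le> 1) \<Longrightarrow> finite J \<Longrightarrow> sum h J \<le> real (card J)" for h :: "'a \<Rightarrow> real" and J
    using sum_bounded_above[of J h 1] by simp
  have card_ge: "(\<forall>i\<in>J. 1 \<le> h i) \<Longrightarrow> finite J \<Longrightarrow> real (card J) \<le> sum h J" for h :: "'a \<Rightarrow> real" and J
    using sum_bounded_below[of J 1 h] by simp
  have r: "0 \<le> b" "b \<le> \<eta>" "\<delta> \<le> a" "0 \<le> c" "c \<le> \<delta>" "\<eta> \<le> d"
  proof -
    show "0 \<le> b" "0 \<le> c" using npos by (auto simp: b_def c_def intro!: divide_nonneg_pos sum_nonneg)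
    have "sum (\<lambda>i. exp (g * (y i - f))) light \<le> \<eta> * n"
      unfolding card_parts(2)[symmetric]
    proof (intro card_le ballI)
      fix i assume "i \<in> light"
      then show "exp (g * (y i - f)) \<le> 1" using g(1) by (simp add: light_def mult_le_0_iff)
    qed (rule parts)
    then show "b \<le> \<eta>" using npos by (simp add: b_def field_simps)
    have "sum (\<lambda>i. exp (- g * (y i - f))) heavy \<le> \<delta> * n"
      unfolding card_parts(1)[symmetric] using g(1) parts
      by (intro card_le) (auto simp: heavy_def)
    then show "c \<le> \<delta>" using npos by (simp add: c_def field_simps)
    have "\<delta> * n \<le> sum (\<lambda>i. exp (g * (y i - f))) heavy"
      unfolding card_parts(1)[symmetric] using g(1) parts
      by (intro card_ge) (auto simp: heavy_def)
    then show "\<delta> \<le> a" using npos by (simp add: a_def heavy_weight_def field_simps)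
    have "\<eta> * n \<le> sum (\<lambda>i. exp (- g * (y i - f))) light"
      unfolding card_parts(2)[symmetric]
    proof (intro card_ge ballI)
      fix i assume "i \<in> light"
      then show "1 \<le> exp (- g * (y i - f))" using g(1) by (simp add: light_def mult_le_0_iff)
    qed (rule parts)
    then show "\<eta> \<le> d" using npos by (simp add: d_def light_weight_def field_simps)
  qed
  have eu: "exp (g * (y i - f)) = exp (g * y i) * exp (- g * f)" for i
    by (simp add: algebra_simps flip: exp_add)
  have ed: "exp (- g * (y i - f)) = exp (- g * y i) * exp (g * f)" for i
    by (simp add: algebra_simps flip: exp_add)
  have ee: "exp (g * f) * exp (- g * f) = 1" and ee': "exp (- g * f) * exp (g * f) = 1"
    by (simp_all flip: exp_add)
  have cancel: "(\<Sum>i\<in>J. h i * E) / n * n * F = sum h J" if "E * F = 1" for h E F and J :: "'a set"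
    using that npos by (simp add: sum_distrib_right[symmetric] mult.assoc)
  have A: "(\<Sum>i\<in>heavy. exp (g * y i)) = a * n * exp (g * f)" "(\<Sum>i\<in>light. exp (g * y i)) = b * n * exp (g * f)"
    unfolding a_def b_def heavy_weight_def eu by (simp_all only: cancel[OF ee'])
  have B: "(\<Sum>i\<in>heavy. exp (- g * y i)) = c * n * exp (- g * f)" "(\<Sum>i\<in>light. exp (- g * y i)) = d * n * exp (- g * f)"
    unfolding c_def d_def light_weight_def ed by (simp_all only: cancel[OF ee])
  have EA: "expsum g I y = (a + b) * n * exp (g * f)" 
    unfolding expsum_def sum_parts A by (simp add: algebra_simps)
  have EB: "expsum (- g) I y = (c + d) * n * exp (- g * f)" 
    unfolding expsum_def sum_parts B by (simp add: algebra_simps)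
  have P: "pairpot g I y = (a + b) * (c + d)"
  proof -
    have "expsum g I y * expsum (- g) I y = (a + b) * (c + d) * n\<^sup>2 * (exp (g * f) * exp (- g * f))"
      unfolding EA EB by (simp add: power2_eq_square)
    then show ?thesis unfolding pairpot_def n[symmetric] ee using npos by simp
  qed
  have ab: "a + b > 0" and cd: "c + d > 0"
    using expsum_pos[of g y] expsum_pos[of "- g" y] npos unfolding EA EB
    by (auto simp: zero_less_mult_iff)
  have sa: "(\<Sum>i\<in>heavy. \<alpha> i) = a / (a + b)"
    unfolding \<alpha>_def sum_divide_distrib[symmetric] A EA using npos ab by simp
  have sb: "(\<Sum>i\<in>heavy. \<beta> i) = c / (c + d)"
    unfolding \<beta>_def sum_divide_distrib[symmetric] B EB using npos cd by simp
  have Dv: "D = (a * d - b * c) / ((a + b) * (c + d))"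
    unfolding D_def sa sb using ab cd by (simp add: field_simps)
  have pos: "(a + b) * (c + d) > 0" using ab cd by simp
  show "0 \<le> D" unfolding Dv using pos mult_diff_nonneg[OF r] by simp
  show "min \<delta> \<eta> \<le> 8 * D" if "25 \<le> pairpot g I y"
    unfolding Dv using pos mult_diff_large[OF r frac(3) that[unfolded P]] by (simp add: pos_le_divide_eq)
  show "1 \<le> 8 * D" if "1/2 \<le> \<delta>" "4 \<le> light_weight"
    unfolding Dv using pos mult_diff_far[OF r frac(3) that(1) that(2)[folded d_def]] by (simp add: pos_le_divide_eq)
  \<comment> \<open>The mirror image: heavy and light are exchanged together with the sign of the
    exponent.\<close>
  show "1 \<le> 8 * D" if "1/2 \<le> \<eta>" "4 \<le> heavy_weight"
    unfolding Dv using pos mult_diff_far[of c \<delta> \<eta> d b a] r frac that(1) that(2)[folded a_def] 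
    by (simp add: pos_le_divide_eq algebra_simps)
qed

section \<open>First order effect and convexity gain of the smoothing factor\<close>

lemma sum_move_diff: "i \<in> I \<Longrightarrow> (\<Sum>j\<in>I. h j * (move I i y j - y j)) = h i - sum h I / n"
proof -
  assume i: "i \<in> I"
  have "h j * (move I i y j - y j) = (if j = i then h j else 0) - h j / n" for j
    by (simp add: move_def n[symmetric] algebra_simps)
  then show ?thesis using fin i by (simp add: sum_subtractf sum_divide_distrib sum.delta)
qed

text \<open>One ball changes the loads by a total of at most 2, and the Huber function has Lipschitz
  constant \<open>R\<close>. The bound is of order \<open>g / n\<close>, although the shares of a
  single bin may be of order 1.\<close>

lemma abs_w_le:
  assumes "i \<in> I"
  shows "\<bar>w i\<bar> \<le> g / (16 * n)"
proof -
  have "\<bar>\<Sum>j\<in>I. huber R (move I i y j) - huber R (y j)\<bar> \<le> (\<Sum>j\<in>I. R * (1 / n + (if j = i then 1 else 0)))"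
  proof (rule order_trans[OF sum_abs sum_mono])
    fix j
    have "\<bar>huber R (y j + (move I i y j - y j)) - huber R (y j)\<bar> \<le> R * \<bar>move I i y j - y j\<bar>"
      using g by (intro huber_lipschitz) auto
    also have "\<dots> \<le> R * (1 / n + (if j = i then 1 else 0))"
    proof (rule mult_left_mono)
      have "1 / n \<le> 1 / 2" "0 < 1 / n" using n2 by (simp_all add: field_simps)
      then show "\<bar>move I i y j - y j\<bar> \<le> 1 / n + (if j = i then 1 else 0)"
        unfolding move_def n[symmetric] by auto
    qed (use g in simp)
    finally show "\<bar>huber R (move I i y j) - huber R (y j)\<bar> \<le> R * (1 / n + (if j = i then 1 else 0))" by simp
  qed
  also have "\<dots> = 2 * R"
    unfolding sum_distrib_left[symmetric] sum.distrib using fin assms npos n ne by (simp add: sum.delta)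
  finally have "\<bar>w i\<bar> \<le> 256 * g\<^sup>2 / n * (2 * R)"
    unfolding w_def abs_mult using npos by (intro mult_mono) auto
  also have "\<dots> = g / (16 * n)" using npos g by (simp add: field_simps power2_eq_square)
  finally show ?thesis .
qed

text \<open>Every bin contributes at least its tangent. The receiving bin moves by
  \<open>1 - 1 / n \<ge> 1/2\<close>, so in the quadratic range it gains another
  \<open>(1/2)\<^sup>2 / 2 = 1/8\<close>. The restriction to \<open>R / 2\<close> keeps it in that
  range after the move, as \<open>R \<ge> 2\<close>.\<close>

lemma w_ge:
  assumes i: "i \<in> I"
  shows "256 * g\<^sup>2 / n * (clamp1 R (y i) - (\<Sum>j\<in>I. clamp1 R (y j)) / n + (if \<bar>y i\<bar> \<le> R / 2 then 1/8 else 0)) \<le> w i"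
proof -
  have R2: "R \<ge> 2" using g_small g(1) by (simp add: field_simps)
  have "clamp1 R (y i) - (\<Sum>j\<in>I. clamp1 R (y j)) / n + (if \<bar>y i\<bar> \<le> R / 2 then 1/8 else 0)
     = (\<Sum>j\<in>I. clamp1 R (y j) * (move I i y j - y j) + (if j = i then (if \<bar>y i\<bar> \<le> R / 2 then 1/8 else 0) else 0))"
    unfolding sum.distrib sum_move_diff[OF i] using fin i by (simp add: sum.delta)
  also have "\<dots> \<le> (\<Sum>j\<in>I. huber R (move I i y j) - huber R (y j))"
  proof (rule sum_mono)
    fix j
    let ?h = "move I i y j - y j"
    show "clamp1 R (y j) * ?h + (if j = i then (if \<bar>y i\<bar> \<le> R / 2 then 1/8 else 0) else 0)
        \<le> huber R (move I i y j) - huber R (y j)"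
    proof (cases "j = i \<and> \<bar>y i\<bar> \<le> R / 2")
      case True
      then have h: "?h = 1 - 1 / n" by (simp add: move_def n[symmetric])
      have "1 / n \<le> 1/2" "1 / n > 0" using n2 by (simp_all add: field_simps)
      then have h2: "1/2 \<le> ?h" "?h \<le> 1" using h by linarith+
      then have "huber R (y j + ?h) = huber R (y j) + clamp1 R (y j) * ?h + ?h\<^sup>2 / 2"
        using True R2 by (intro huber_strongly_convex) auto
      moreover have "(1/2)\<^sup>2 \<le> ?h\<^sup>2" using h2 by (intro power_mono) auto
      ultimately show ?thesis using True by (simp add: power2_eq_square)
    next
      case False
      then show ?thesis using huber_convex[of R "y j" ?h] g by auto
    qed
  qed
  finally show ?thesis unfolding w_def using npos by (intro mult_left_mono) auto
qed

definition "huber_gain = (\<Sum>i\<in>I. p i * (if \<bar>y i\<bar> \<le> R / 2 then 1/8 else 0))"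

lemma huber_gain_nonneg: "0 \<le> huber_gain" unfolding huber_gain_def using p_nonneg by (auto intro!: sum_nonneg)

text \<open>The mean of the tangent terms is \<open>\<delta>\<close> times the light part of the sum
  of clamped loads minus \<open>\<eta>\<close> times the heavy part, divided by \<open>n\<close>. It
  is thus at most \<open>2 * R * \<delta> * \<eta>\<close> in absolute value and fades when nearly
  all bins are on one side, which is where \<open>huber_gain\<close> is needed.\<close>

lemma sum_p_w_ge: "256 * g\<^sup>2 / n * huber_gain - g * \<delta> * \<eta> / (16 * n) \<le> (\<Sum>i\<in>I. p i * w i)"
proof -
  let ?c = "\<lambda>i. clamp1 R (y i)"
  have R: "R \<ge> 0" using g by simp
  have lr: "\<bar>sum ?c J\<bar> \<le> real (card J) * R" for J
    by (rule order_trans[OF sum_abs]) (rule sum_bounded_above[of J "\<lambda>i. \<bar>?c i\<bar>", OF abs_clamp1_le[OF R]])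
  have "(\<Sum>i\<in>I. p i * (?c i - (\<Sum>j\<in>I. ?c j) / n)) = (\<Sum>i\<in>I. p i * ?c i) - (\<Sum>j\<in>I. ?c j) / n"
    by (simp only: right_diff_distrib sum_subtractf sum_p_const)
  also have "\<dots> = (\<delta> * sum ?c light - \<eta> * sum ?c heavy) / n"
    unfolding sum_p sum_parts[of ?c] \<eta>_def using npos by (simp add: field_simps)
  also have "\<dots> \<ge> (- (\<delta> * (\<eta> * n * R)) - \<eta> * (\<delta> * n * R)) / n"
  proof (rule divide_right_mono)
    have "- (\<eta> * n * R) \<le> sum ?c light"
      using lr[of light] card_parts by (simp only: abs_le_iff) linarith
    then have "- (\<delta> * (\<eta> * n * R)) \<le> \<delta> * sum ?c light"
      using mult_left_mono[of "- (\<eta> * n * R)" "sum ?c light" \<delta>] frac by (simp only: mult_minus_right)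
    moreover have "\<eta> * sum ?c heavy \<le> \<eta> * (\<delta> * n * R)"
      using lr[of heavy] card_parts frac by (intro mult_left_mono) auto
    ultimately show "- (\<delta> * (\<eta> * n * R)) - \<eta> * (\<delta> * n * R) \<le> \<delta> * sum ?c light - \<eta> * sum ?c heavy"
      by (rule diff_mono)
  qed (use npos in simp)
  finally have 1: "- 2 * R * \<delta> * \<eta> \<le> (\<Sum>i\<in>I. p i * (?c i - (\<Sum>j\<in>I. ?c j) / n))"
    using npos by (simp add: field_simps)
  have "256 * g\<^sup>2 / n * huber_gain - g * \<delta> * \<eta> / (16 * n) = 256 * g\<^sup>2 / n * (- 2 * R * \<delta> * \<eta> + huber_gain)"
    using npos g by (simp add: field_simps power2_eq_square)
  also have "\<dots> \<le> 256 * g\<^sup>2 / n * ((\<Sum>i\<in>I. p i * (?c i - (\<Sum>j\<in>I. ?c j) / n)) + huber_gain)"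
    using 1 npos by (intro mult_left_mono) auto
  also have "\<dots> = (\<Sum>i\<in>I. p i * (256 * g\<^sup>2 / n * (?c i - (\<Sum>j\<in>I. ?c j) / n + (if \<bar>y i\<bar> \<le> R / 2 then 1/8 else 0))))"
    unfolding huber_gain_def sum_distrib_left sum.distrib[symmetric] by (intro sum.cong) (simp_all add: algebra_simps)
  also have "\<dots> \<le> (\<Sum>i\<in>I. p i * w i)"
    by (intro sum_mono mult_left_mono w_ge p_nonneg)
  finally show ?thesis .
qed

section \<open>The mean relative change of the potential in one step\<close>

lemma exp_g: "exp g - 1 \<le> g + g\<^sup>2" "g \<le> exp g - 1" "1 - exp (- g) \<le> g" "g - g\<^sup>2 \<le> 1 - exp (- g)" "0 < 1 - exp (- g)"
proof -
  have "exp g \<le> 1 + g + g\<^sup>2" "exp (- g) \<le> 1 - g + g\<^sup>2"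
    using g g_small by (auto intro!: exp_bound exp_minus_le_quadratic)
  moreover have "1 + g \<le> exp g" "1 + - g \<le> exp (- g)" by (rule exp_ge_add_one_self)+
  ultimately show "exp g - 1 \<le> g + g\<^sup>2" "g \<le> exp g - 1" "1 - exp (- g) \<le> g" "g - g\<^sup>2 \<le> 1 - exp (- g)"
    by linarith+
qed (use g in simp)

text \<open>The product of the two share terms enters with a negative sign and is dropped. As
  \<open>w i\<close> is of order \<open>g / n\<close>, its product with the change of the pair
  potential and its square cost only \<open>3/16\<close> and \<open>2/16\<close> of
  \<open>g\<^sup>2 / n\<close>.\<close>

lemma ratio_le:
  assumes i: "i \<in> I"
  shows "ratio i \<le> 1 + (g + g\<^sup>2) * \<alpha> i - (g - g\<^sup>2) * \<beta> i - w i + g\<^sup>2 / (2 * n)"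
proof -
  let ?u = "(exp g - 1) * \<alpha> i" and ?v = "(1 - exp (- g)) * \<beta> i"
  let ?Q = "(1 + ?u) * (1 - ?v)"
  note sh = shares(1,2)[of i] share_le_1[OF i]
  have gg: "g\<^sup>2 \<le> g" using g g_small by (simp add: power2_eq_square mult_left_le)
  have u: "0 \<le> ?u" "?u \<le> (g + g\<^sup>2) * \<alpha> i" using exp_g g sh by (auto intro!: mult_right_mono mult_nonneg_nonneg)
  have u2: "?u \<le> 2 * g"
  proof -
    note u(2)
    also have "(g + g\<^sup>2) * \<alpha> i \<le> (g + g\<^sup>2) * 1" using sh g by (intro mult_left_mono) auto
    also have "\<dots> \<le> 2 * g" using gg by simp
    finally show ?thesis .
  qed
  have v: "0 \<le> ?v" "(g - g\<^sup>2) * \<beta> i \<le> ?v" using exp_g g sh by (auto intro!: mult_right_mono mult_nonneg_nonneg)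
  have v2: "?v \<le> g" using mult_mono[of "1 - exp (- g)" g "\<beta> i" 1] sh exp_g g by auto
  have uv: "0 \<le> ?u * ?v" "?u * ?v \<le> ?u * 1"
    using u(1) v(1) v2 g_small by (blast intro: mult_nonneg_nonneg, intro mult_left_mono) auto
  have Qe: "?Q = 1 + ?u - ?v - ?u * ?v" by (simp add: algebra_simps)
  have Q: "?Q \<le> 1 + ?u - ?v" "\<bar>?Q - 1\<bar> \<le> 3 * g" "0 \<le> ?Q" "?Q \<le> 2"
    unfolding Qe using uv u u2 v v2 g_small by linarith+
  have W: "\<bar>w i\<bar> \<le> g / (16 * n)" by (rule abs_w_le[OF i])
  have gn: "g / (16 * n) \<le> g / 16" using n2 g by (intro divide_left_mono) auto
  have "ratio i = ?Q * exp (- w i)" by (simp add: ratio_def)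
  also have "\<dots> \<le> ?Q * (1 - w i + (w i)\<^sup>2)"
    using Q W gn g_small by (intro mult_left_mono exp_minus_le_quadratic) auto
  also have "\<dots> = ?Q - w i + - ((?Q - 1) * w i) + ?Q * (w i)\<^sup>2" by (simp add: algebra_simps)
  also have "- ((?Q - 1) * w i) \<le> (3 * g) * (g / (16 * n))"
  proof -
    have "- ((?Q - 1) * w i) \<le> \<bar>?Q - 1\<bar> * \<bar>w i\<bar>" by (metis abs_ge_minus_self abs_mult)
    also have "\<dots> \<le> (3 * g) * (g / (16 * n))" using Q W g by (intro mult_mono) auto
    finally show ?thesis .
  qed
  also have "?Q * (w i)\<^sup>2 \<le> 2 * (g\<^sup>2 / (16 * n))"
  proof (rule mult_mono)
    have "(w i)\<^sup>2 \<le> (g / (16 * n))\<^sup>2" using W by (metis abs_ge_zero power2_abs power_mono)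
    also have "\<dots> \<le> (g / (16 * n)) * g" using gn g npos unfolding power2_eq_square
      by (intro mult_left_mono) auto
    finally show "(w i)\<^sup>2 \<le> g\<^sup>2 / (16 * n)" by (simp add: power2_eq_square)
  qed (use Q in auto)
  finally have "ratio i \<le> ?Q - w i + 5 * (g\<^sup>2 / (16 * n))"
    by (simp add: power2_eq_square)
  moreover have "5 * (g\<^sup>2 / (16 * n)) \<le> g\<^sup>2 / (2 * n)" using npos by (simp add: field_simps)
  ultimately show ?thesis using Q(1) u(2) v(2) by linarith
qed

text \<open>Under \<open>p\<close> the means of \<open>\<alpha>\<close> and \<open>\<beta>\<close>
  differ only through their heavy shares, which leaves \<open>- g * D / n\<close> in first order.
  The constant \<open>9/2\<close> collects 2 for each of these two means and \<open>1/2\<close> from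
  \<open>ratio_le\<close>.\<close>

lemma mean_ratio_le:
  "(\<Sum>i\<in>I. p i * ratio i) \<le>
    1 + (g * (9/2 * g - D + \<delta> * \<eta> / 16) - 256 * g\<^sup>2 * huber_gain) / n"
proof -
  have "(\<Sum>i\<in>I. p i * ratio i) \<le> (\<Sum>i\<in>I. p i * (1 + (g + g\<^sup>2) * \<alpha> i - (g - g\<^sup>2) * \<beta> i - w i + g\<^sup>2 / (2 * n)))"
    by (intro sum_mono mult_left_mono ratio_le p_nonneg)
  also have "\<dots> = 1 + (g + g\<^sup>2) * (\<Sum>i\<in>I. p i * \<alpha> i) - (g - g\<^sup>2) * (\<Sum>i\<in>I. p i * \<beta> i) - (\<Sum>i\<in>I. p i * w i) + g\<^sup>2 / (2 * n)"
  proof -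
    have "p i * (1 + (g + g\<^sup>2) * \<alpha> i - (g - g\<^sup>2) * \<beta> i - w i + g\<^sup>2 / (2 * n))
      = p i * 1 + (g + g\<^sup>2) * (p i * \<alpha> i) - (g - g\<^sup>2) * (p i * \<beta> i) - p i * w i + p i * (g\<^sup>2 / (2 * n))" for i
      by (simp add: algebra_simps)
    then show ?thesis
      by (simp only: sum.distrib sum_subtractf sum_distrib_left[symmetric] sum_p_const)
  qed
  also have "(\<Sum>i\<in>I. p i * \<alpha> i) = (1 + \<delta> - sum \<alpha> heavy) / n"
    unfolding sum_p using shares(3) sum_parts[of \<alpha>] by simp
  also have "(\<Sum>i\<in>I. p i * \<beta> i) = (1 + \<delta> - sum \<beta> heavy) / n"
    unfolding sum_p using shares(4) sum_parts[of \<beta>] by simp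
  finally have "(\<Sum>i\<in>I. p i * ratio i) \<le> 1 + (g + g\<^sup>2) * ((1 + \<delta> - sum \<alpha> heavy) / n)
      - (g - g\<^sup>2) * ((1 + \<delta> - sum \<beta> heavy) / n) - (\<Sum>i\<in>I. p i * w i) + g\<^sup>2 / (2 * n)" .
  also have "\<dots> = 1 + (- g * D + g\<^sup>2 * ((1 + \<delta> - sum \<alpha> heavy) + (1 + \<delta> - sum \<beta> heavy) + 1/2)) / n - (\<Sum>i\<in>I. p i * w i)"
    using npos by (simp add: D_def field_simps)
  also have "\<dots> \<le> 1 + (- g * D + g\<^sup>2 * (9/2)) / n - (256 * g\<^sup>2 / n * huber_gain - g * \<delta> * \<eta> / (16 * n))"
  proof (intro diff_mono add_left_mono divide_right_mono)
    show "g\<^sup>2 * (1 + \<delta> - sum \<alpha> heavy + (1 + \<delta> - sum \<beta> heavy) + 1/2) \<le> g\<^sup>2 * (9/2)"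
      using heavy_share frac by (intro mult_left_mono) auto
  qed (use sum_p_w_ge npos in auto)
  also have "\<dots> = 1 + (g * (9/2 * g - D + \<delta> * \<eta> / 16) - 256 * g\<^sup>2 * huber_gain) / n"
    using npos by (simp add: field_simps power2_eq_square)
  finally show ?thesis .
qed

text \<open>
  In the degenerate case few bins lie on one side of the threshold and these have a moderate
  exponential weight. Since the loads sum to zero, all loads are then small on average.
\<close>

lemma le_exp_amgm: 
  assumes "0 \<le> (v::real)" 
  shows "2 * v \<le> 2 / 2 ^ 20 * exp v + 2 ^ 20"
proof -
  have "1 + v + v\<^sup>2 / 2 \<le> exp v" using exp_lower_Taylor_quadratic[OF assms] .
  moreover have "0 \<le> (v - 2 ^ 20)\<^sup>2" by simp
  then have "2 * v \<le> v\<^sup>2 / 2 ^ 20 + 2 ^ 20" by (simp add: power2_eq_square field_simps)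
  ultimately show ?thesis using assms by (simp add: field_simps)
qed

text \<open>As the loads sum to zero, \<open>\<bar>y i\<bar>\<close> may be replaced by
  \<open>\<bar>y i\<bar> - y i\<close> or by \<open>\<bar>y i\<bar> + y i\<close>. The first
  vanishes on heavy bins and the second is at most \<open>2 * f\<close> on light ones, so the main
  contribution is that of the rare side. There \<open>le_exp_amgm\<close> puts a small coefficient
  on the bounded exponential weight and a large constant on the small number of bins.\<close>

lemma sum_abs_small:
  assumes "(\<eta> \<le> 128 * g \<and> light_weight < 4) \<or> (\<delta> \<le> 128 * g \<and> heavy_weight < 4)"
  shows "g * (\<Sum>i\<in>I. \<bar>y i\<bar>) \<le> n / 65536"
  using assms
proof
  assume a: "\<eta> \<le> 128 * g \<and> light_weight < 4"
  have "g * (\<Sum>i\<in>I. \<bar>y i\<bar>) = (\<Sum>i\<in>I. g * (\<bar>y i\<bar> - y i))"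
    using sum0 by (simp add: sum_distrib_left[symmetric] sum_subtractf)
  also have "\<dots> = (\<Sum>i\<in>light. g * (\<bar>y i\<bar> - y i))"
  proof -
    have "(\<Sum>i\<in>heavy. g * (\<bar>y i\<bar> - y i)) = 0" using f by (intro sum.neutral) (auto simp: heavy_def)
    then show ?thesis using sum_parts by simp
  qed
  also have "\<dots> \<le> (\<Sum>i\<in>light. 2 / 2 ^ 20 * exp (- g * (y i - f)) + 2 ^ 20)"
  proof (rule sum_mono)
    fix i assume i: "i \<in> light"
    have "g * (\<bar>y i\<bar> - y i) \<le> g * (2 * (f - y i))" using i f g by (intro mult_left_mono) (auto simp: light_def)
    also have "\<dots> = 2 * (- g * (y i - f))" by (simp add: algebra_simps)
    also have "\<dots> \<le> 2 / 2 ^ 20 * exp (- g * (y i - f)) + 2 ^ 20"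
      using i g by (intro le_exp_amgm) (auto simp: light_def mult_le_0_iff)
    finally show "g * (\<bar>y i\<bar> - y i) \<le> \<dots>" .
  qed
  also have "\<dots> = 2 / 2 ^ 20 * (light_weight * n) + 2 ^ 20 * (\<eta> * n)"
  proof -
    have 2: "(\<Sum>i\<in>light. exp (- g * (y i - f))) = light_weight * n" using npos by (simp add: light_weight_def)
    have 3: "(\<Sum>i\<in>light. (2::real) ^ 20) = 2 ^ 20 * (\<eta> * n)" by (simp only: sum_constant card_parts mult.commute)
    show ?thesis unfolding sum.distrib sum_distrib_left[symmetric] 2 3 ..
  qed
  \<comment> \<open>The bound \<open>1 / 2 ^ 46\<close> on the rate enters here: the summands are
    \<open>n / 2 ^ 17\<close> and \<open>n / 2 ^ 19\<close>, together below
    \<open>n / 2 ^ 16\<close>.\<close>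
  also have "\<dots> \<le> 2 / 2 ^ 20 * (4 * n) + 2 ^ 20 * (128 * (1 / 2 ^ 46) * n)"
    using a g npos by (intro add_mono mult_left_mono mult_right_mono) auto
  also have "\<dots> \<le> n / 65536" using npos by simp
  finally show ?thesis .
next
  assume a: "\<delta> \<le> 128 * g \<and> heavy_weight < 4"
  have "g * (\<Sum>i\<in>I. \<bar>y i\<bar>) = (\<Sum>i\<in>I. g * (\<bar>y i\<bar> + y i))"
    using sum0 by (simp add: sum_distrib_left[symmetric] sum.distrib)
  also have "\<dots> = (\<Sum>i\<in>heavy. g * (\<bar>y i\<bar> + y i)) + (\<Sum>i\<in>light. g * (\<bar>y i\<bar> + y i))" by (rule sum_parts)
  also have "\<dots> \<le> (\<Sum>i\<in>heavy. (2 / 2 ^ 20 * exp (g * (y i - f)) + 2 ^ 20) + 2 * (g * f)) + (\<Sum>i\<in>light. 2 * (g * f))"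
  proof (intro add_mono sum_mono)
    fix i assume i: "i \<in> heavy"
    have "g * (\<bar>y i\<bar> + y i) = 2 * (g * (y i - f)) + 2 * (g * f)" using i f g by (auto simp: heavy_def algebra_simps)
    also have "\<dots> \<le> (2 / 2 ^ 20 * exp (g * (y i - f)) + 2 ^ 20) + 2 * (g * f)"
      using i g by (intro add_mono le_exp_amgm) (auto simp: heavy_def)
    finally show "g * (\<bar>y i\<bar> + y i) \<le> \<dots>" .
  next
    fix i assume i: "i \<in> light"
    have "g * (\<bar>y i\<bar> + y i) \<le> g * (2 * f)" using i f g by (intro mult_left_mono) (auto simp: light_def)
    then show "g * (\<bar>y i\<bar> + y i) \<le> 2 * (g * f)" by simp
  qed
  also have "\<dots> = 2 / 2 ^ 20 * (heavy_weight * n) + 2 ^ 20 * (\<delta> * n) + 2 * (g * f) * n"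
  proof -
    have 1: "(\<Sum>i\<in>heavy. 2 * (g * f)) + (\<Sum>i\<in>light. 2 * (g * f)) = 2 * (g * f) * n"
      using sum_parts[of "\<lambda>_. 2 * (g * f)"] n by (simp add: mult.commute)
    have 2: "(\<Sum>i\<in>heavy. exp (g * (y i - f))) = heavy_weight * n" using npos by (simp add: heavy_weight_def)
    have 3: "(\<Sum>i\<in>heavy. (2::real) ^ 20) = 2 ^ 20 * (\<delta> * n)" by (simp only: sum_constant card_parts mult.commute)
    show ?thesis
      using 1 unfolding sum.distrib sum_distrib_left[symmetric] 2 3 by linarith
  qed
  also have "\<dots> \<le> 2 / 2 ^ 20 * (4 * n) + 2 ^ 20 * (128 * (1 / 2 ^ 46) * n) + 2 * (1 / 2 ^ 46) * n"
    using a g npos by (intro add_mono mult_left_mono mult_right_mono) auto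
  also have "\<dots> \<le> n / 65536" using npos by simp
  finally show ?thesis .
qed

text \<open>By Markov's inequality at most a quarter of the bins leave the range
  \<open>R / 2\<close>. At least half of the bins are inside and have probability at least
  \<open>1 / (2 * n)\<close>: every bin has it if heavy bins are the majority, and otherwise every
  light bin does. The value is \<open>n / 2\<close> times \<open>1 / (2 * n)\<close> times
  \<open>1/8\<close>.\<close>

lemma huber_gain_large:
  assumes "(\<eta> \<le> 128 * g \<and> light_weight < 4) \<or> (\<delta> \<le> 128 * g \<and> heavy_weight < 4)"
  shows "1/32 \<le> huber_gain"
proof -
  define out where "out = {i \<in> I. R / 2 < \<bar>y i\<bar>}"
  have "real (card out) * (R / 2) \<le> (\<Sum>i\<in>out. \<bar>y i\<bar>)"
    using sum_bounded_below[of out "R / 2" "\<lambda>i. \<bar>y i\<bar>"] by (auto simp: out_def)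
  also have "\<dots> \<le> (\<Sum>i\<in>I. \<bar>y i\<bar>)" using fin by (intro sum_mono2) (auto simp: out_def)
  finally have "real (card out) * (R / 2) * g \<le> (\<Sum>i\<in>I. \<bar>y i\<bar>) * g"
    by (rule mult_right_mono) (use g in simp)
  also have "\<dots> = g * (\<Sum>i\<in>I. \<bar>y i\<bar>)" by (rule mult.commute)
  also have "\<dots> \<le> n / 65536" using sum_abs_small[OF assms] .
  finally have "real (card out) * (R / 2) * g \<le> n / 65536" .
  moreover have "real (card out) * (R / 2) * g = real (card out) / 16384" using g by simp
  ultimately have out: "real (card out) \<le> n / 4" by linarith
  define good where "good = {i \<in> I. \<bar>y i\<bar> \<le> R / 2 \<and> 1 / (2 * n) \<le> p i}"
  have h: "1 / (2 * n) \<le> 1 / n" using npos by (simp add: field_simps)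
  have "n / 2 \<le> real (card good)"
  proof (cases "\<delta> \<ge> 1/2")
    case True
    have "1 / (2 * n) \<le> p i" for i
      using p_heavy[of i] divide_right_mono[OF True, of n] npos by simp
    then have "good = I - out" by (auto simp: good_def out_def)
    then have "real (card good) = n - real (card out)"
      using fin n by (simp add: card_Diff_subset out_def of_nat_diff card_mono)
    then show ?thesis using out npos by linarith
  next
    case False
    then have "\<delta> \<le> 1/4" using assms g_small frac by auto
    then have "\<delta> * n \<le> (1/4) * n" using npos by (intro mult_right_mono) auto
    moreover have "I - (out \<union> heavy) \<subseteq> good"
      using p_light h by (force simp: good_def out_def heavy_def light_def)
    then have "card (I - (out \<union> heavy)) \<le> card good"
      using fin by (intro card_mono) (auto simp: good_def)
    moreover have "card I - card (out \<union> heavy) \<le> card (I - (out \<union> heavy))" by (rule diff_card_le_card_Diff) (use fin in \<open>auto simp: out_def heavy_def\<close>)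
    moreover have "card (out \<union> heavy) \<le> card out + card heavy" by (rule card_Un_le)
    ultimately show ?thesis using out card_parts(1) n by linarith
  qed
  then have "1/32 \<le> real (card good) * (1 / (2 * n) * (1/8))" using npos by (simp add: field_simps)
  also have "\<dots> \<le> (\<Sum>i\<in>good. p i * (1/8))"
    using sum_bounded_below[of good "1 / (2 * n) * (1/8)" "\<lambda>i. p i * (1/8)"] by (auto simp: good_def)
  also have "\<dots> = (\<Sum>i\<in>good. p i * (if \<bar>y i\<bar> \<le> R / 2 then 1/8 else 0))"
    by (intro sum.cong) (auto simp: good_def)
  also have "\<dots> \<le> huber_gain" unfolding huber_gain_def
    using fin p_nonneg by (intro sum_mono2) (auto simp: good_def)
  finally show ?thesis .
qed

section \<open>Drift outside and inside the degenerate case\<close>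

lemma \<delta>\<eta>_le: "\<delta> * \<eta> \<le> min \<delta> \<eta>" "min \<delta> \<eta> \<le> 1"
  using frac mult_left_le[of \<eta> \<delta>] mult_right_le_one_le[of \<eta> \<delta>] 
  by (auto simp: min_def mult_left_le mult.commute)

lemma mean_ratio_general: "(\<Sum>i\<in>I. p i * ratio i) \<le> 1 + g / n"
proof -
  have "g * (9/2 * g - D + \<delta> * \<eta> / 16) - 256 * g\<^sup>2 * huber_gain \<le> g * 1 - 0"
    using D_nonneg \<delta>\<eta>_le g g_small huber_gain_nonneg by (intro diff_mono mult_left_mono) auto
  then have "(g * (9/2 * g - D + \<delta> * \<eta> / 16) - 256 * g\<^sup>2 * huber_gain) / n \<le> g / n"
    using npos by (intro divide_right_mono) auto
  then show ?thesis using mean_ratio_le by linarith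
qed

text \<open>This is where the constants of \<open>smoothing\<close> fit together. Its first order
  cost \<open>g * \<delta> * \<eta> / 16\<close> is at most half of the guaranteed
  \<open>g * min \<delta> \<eta> / 8\<close>, and if both sides hold more than
  \<open>128 * g\<close> of the bins, the rest exceeds \<open>8 * g\<^sup>2\<close>, which beats the
  second order terms. If the smaller side has weight at least 4, then \<open>D \<ge> 1/8\<close>. In
  the remaining case the convexity gain \<open>256 * g\<^sup>2 / 32 = 8 * g\<^sup>2\<close> has to
  win against at most \<open>5 * g\<^sup>2\<close>.\<close>

lemma mean_ratio_large:
  assumes "25 \<le> pairpot g I y"
  shows "(\<Sum>i\<in>I. p i * ratio i) \<le> 1 - g\<^sup>2 / n"
proof -
  have "g * (9/2 * g - D + \<delta> * \<eta> / 16) - 256 * g\<^sup>2 * huber_gain \<le> - g\<^sup>2"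
  proof (cases "128 * g < min \<delta> \<eta>")
    case True
    have "9/2 * g - D + \<delta> * \<eta> / 16 \<le> - g"
      using True D_large[OF assms] \<delta>\<eta>_le(1) g(1) by linarith
    then have "g * (9/2 * g - D + \<delta> * \<eta> / 16) \<le> g * (- g)" using g by (intro mult_left_mono) auto
    moreover have "0 \<le> 256 * g\<^sup>2 * huber_gain" using huber_gain_nonneg by simp
    ultimately show ?thesis by (simp add: power2_eq_square)
  next
    case False
    then consider "(\<eta> \<le> 128 * g \<and> light_weight < 4) \<or> (\<delta> \<le> 128 * g \<and> heavy_weight < 4)" | "1 \<le> 8 * D"
    proof (cases "\<eta> \<le> 128 * g")
      case True
      then have "1/2 \<le> \<delta>" using g_small frac by linarith
      then show ?thesis using that True D_far1 by linarith
    next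
      case \<eta>: False
      then have "\<delta> \<le> 128 * g" using False by (simp add: min_def split: if_splits)
      moreover from this have "1/2 \<le> \<eta>" using g_small frac by linarith
      ultimately show ?thesis using that D_far2 by linarith
    qed
    then show ?thesis
    proof cases
      case 1
      have "9/2 * g - D + \<delta> * \<eta> / 16 \<le> 5 * g" 
        using D_large[OF assms] \<delta>\<eta>_le(1) g(1) mult_nonneg_nonneg[OF frac(1,2)] by linarith
      then have "g * (9/2 * g - D + \<delta> * \<eta> / 16) \<le> g * (5 * g)" using g by (intro mult_left_mono) auto
      moreover have "g * (5 * g) = 5 * g\<^sup>2" by (simp add: power2_eq_square)
      moreover have "8 * g\<^sup>2 \<le> 256 * g\<^sup>2 * huber_gain" using mult_left_mono[OF huber_gain_large[OF 1], of "256 * g\<^sup>2"] by simp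
      moreover have "0 \<le> g\<^sup>2" by simp
      ultimately show ?thesis by linarith
    next
      case 2
      have "9/2 * g - D + \<delta> * \<eta> / 16 \<le> - g"
        using 2 \<delta>\<eta>_le g_small by linarith
      then have "g * (9/2 * g - D + \<delta> * \<eta> / 16) \<le> g * (- g)" using g by (intro mult_left_mono) auto
      moreover have "0 \<le> 256 * g\<^sup>2 * huber_gain" using huber_gain_nonneg by simp
      ultimately show ?thesis by (simp add: power2_eq_square)
    qed
  qed
  then have "(g * (9/2 * g - D + \<delta> * \<eta> / 16) - 256 * g\<^sup>2 * huber_gain) / n \<le> - g\<^sup>2 / n"
    using npos by (intro divide_right_mono) auto
  then show ?thesis using mean_ratio_le by simp
qed

end

subsection \<open>Consequences of a bounded potential or spread\<close>

definition overload :: "real \<Rightarrow> real \<Rightarrow> 'a set \<Rightarrow> ('a \<Rightarrow> real) \<Rightarrow> real" where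
  "overload a f I y = (\<Sum>i\<in>I. exp (a * (y i - f)))"

context balanced
begin

section \<open>Drift of the potential and its comparison with the pair potential\<close>

lemma potential_le_pairpot: "potential g I y \<le> pairpot g I y"
proof -
  have "0 \<le> (\<Sum>i\<in>I. huber R (y i))" using g by (intro sum_nonneg huber_nonneg) auto
  then have "smoothing g I y \<le> 1"
    using npos unfolding smoothing_def n[symmetric] by (simp add: divide_nonneg_pos)
  then show ?thesis unfolding potential_def using pairpot_pos by (simp add: mult_left_le)
qed

lemma mean_potential: "(\<Sum>i\<in>I. p i * potential g I (move I i y)) = potential g I y * (\<Sum>i\<in>I. p i * ratio i)"
  by (simp add: potential_move sum_distrib_left algebra_simps)

text \<open>Below 25 the pair potential also bounds the potential by 25, and the latter grows at
  most by the factor \<open>1 + g / n\<close> in the mean; together with the term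
  \<open>g\<^sup>2 / n\<close> this gives the constant 50.\<close>

lemma potential_drift:
  "(\<Sum>i\<in>I. p i * potential g I (move I i y)) \<le> (1 - g\<^sup>2 / n) * potential g I y + 50 * g / n"
proof (cases "25 \<le> pairpot g I y")
  case True
  have "potential g I y * (\<Sum>i\<in>I. p i * ratio i) \<le> potential g I y * (1 - g\<^sup>2 / n)"
    using mean_ratio_large[OF True] potential_pos by (intro mult_left_mono) auto
  moreover have "0 \<le> 50 * g / n" using g npos by simp
  ultimately show ?thesis unfolding mean_potential by (simp add: mult.commute)
next
  case False
  have "potential g I y * (\<Sum>i\<in>I. p i * ratio i) \<le> potential g I y * (1 + g / n)"
    using mean_ratio_general potential_pos by (intro mult_left_mono) auto
  also have "\<dots> = (1 - g\<^sup>2 / n) * potential g I y + potential g I y * ((g + g\<^sup>2) / n)"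
    by (simp add: algebra_simps add_divide_distrib)
  also have "potential g I y * ((g + g\<^sup>2) / n) \<le> 25 * (2 * g / n)"
  proof (intro mult_mono divide_right_mono)
    have "g\<^sup>2 \<le> g" using g g_small by (simp add: power2_eq_square mult_left_le)
    then show "g + g\<^sup>2 \<le> 2 * g" by simp
  qed (use False potential_le_pairpot g npos in auto)
  finally show ?thesis unfolding mean_potential by simp
qed

text \<open>Jensen's inequality, through the tangent of \<open>exp\<close> at the mean, bounds the
  left side by \<open>A + B\<close>, where \<open>A\<close> and \<open>B\<close> are the two
  exponential sums divided by \<open>n\<close>. Both are at least 1 because the loads sum to zero,
  so \<open>(A - 1) * (B - 1) \<ge> 0\<close> yields \<open>A + B \<le> 2 * A * B\<close>.\<close>

lemma mean_abs_le: "exp (g * (\<Sum>i\<in>I. \<bar>y i\<bar>) / n) \<le> 2 * pairpot g I y"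
proof -
  let ?m = "g * (\<Sum>i\<in>I. \<bar>y i\<bar>) / n"
  have ge_n: "n \<le> expsum c I y" for c
  proof -
    have "(\<Sum>i\<in>I. 1 + c * y i) \<le> expsum c I y"
      unfolding expsum_def by (intro sum_mono exp_ge_add_one_self)
    then show ?thesis using sum0 n by (simp add: sum.distrib sum_distrib_left[symmetric])
  qed
  have "exp ?m * n = (\<Sum>i\<in>I. exp ?m * (1 + (g * \<bar>y i\<bar> - ?m)))"
    using npos n by (simp add: sum_distrib_left[symmetric] sum.distrib sum_subtractf)
  also have "\<dots> \<le> (\<Sum>i\<in>I. exp (g * y i) + exp (- g * y i))"
  proof (rule sum_mono)
    fix i
    have "exp ?m * (1 + (g * \<bar>y i\<bar> - ?m)) \<le> exp ?m * exp (g * \<bar>y i\<bar> - ?m)"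
      by (intro mult_left_mono exp_ge_add_one_self) auto
    also have "\<dots> = exp (g * \<bar>y i\<bar>)" by (simp flip: exp_add)
    also have "\<dots> \<le> exp (g * y i) + exp (- g * y i)" by (cases "y i \<ge> 0") auto
    finally show "exp ?m * (1 + (g * \<bar>y i\<bar> - ?m)) \<le> exp (g * y i) + exp (- g * y i)" .
  qed
  also have "\<dots> = expsum g I y + expsum (- g) I y" by (simp add: expsum_def sum.distrib)
  finally have 1: "exp ?m * n \<le> expsum g I y + expsum (- g) I y" .
  have "0 \<le> (expsum g I y - n) * (expsum (- g) I y - n)" using ge_n by (intro mult_nonneg_nonneg) auto
  then have 2: "n * (expsum g I y + expsum (- g) I y) \<le> expsum g I y * expsum (- g) I y + n * n"
    by (simp add: algebra_simps)
  have 3: "n * n \<le> expsum g I y * expsum (- g) I y" using ge_n npos by (intro mult_mono) (auto intro: order_trans[OF less_imp_le])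
  have "n * (exp ?m * n) \<le> n * (expsum g I y + expsum (- g) I y)" using 1 npos by (intro mult_left_mono) auto
  then have "exp ?m * n\<^sup>2 \<le> 2 * (expsum g I y * expsum (- g) I y)" 
    using 2 3 by (simp add: power2_eq_square algebra_simps)
  then show ?thesis using npos by (simp add: pairpot_def n[symmetric] pos_le_divide_eq)
qed

text \<open>The exponent \<open>H\<close> of the smoothing factor is at most linear in the mean
  absolute load, so \<open>mean_abs_le\<close> gives
  \<open>exp (2 * H) \<le> 2 * pairpot g I y\<close>. Smoothing thus costs at most a square root,
  and bounds on the potential carry over.\<close>

lemma pairpot_le_potential: "pairpot g I y \<le> 2 * (potential g I y)\<^sup>2"
proof -
  let ?S = "\<Sum>i\<in>I. \<bar>y i\<bar>" and ?P = "pairpot g I y"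
  define H where "H = 256 * g\<^sup>2 / n * (\<Sum>i\<in>I. huber R (y i))"
  have "H \<le> 256 * g\<^sup>2 / n * (\<Sum>i\<in>I. R * \<bar>y i\<bar>)"
    unfolding H_def using g npos by (intro mult_left_mono sum_mono huber_le) auto
  also have "\<dots> = (g * ?S / n) / 32" unfolding sum_distrib_left[symmetric] using g npos by (simp add: power2_eq_square)
  also have "\<dots> \<le> (g * ?S / n) / 2" using g npos by (intro divide_left_mono mult_nonneg_nonneg divide_nonneg_pos sum_nonneg) auto
  finally have "2 * H \<le> g * ?S / n" by (simp only: pos_le_divide_eq[of 2] zero_less_numeral mult.commute)
  then have "exp (2 * H) \<le> exp (g * ?S / n)" by simp
  also have "\<dots> \<le> 2 * ?P" by (rule mean_abs_le)
  finally have e: "exp (2 * H) \<le> 2 * ?P" .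
  have "?P * exp (2 * H) \<le> ?P * (2 * ?P)" using e pairpot_pos by (intro mult_left_mono) auto
  then have "?P * exp (2 * H) * exp (- 2 * H) \<le> ?P * (2 * ?P) * exp (- 2 * H)" by (intro mult_right_mono) auto
  also have "?P * exp (2 * H) * exp (- 2 * H) = ?P" by (simp add: mult.assoc flip: exp_add)
  also have "exp (- 2 * H) = (exp (- H))\<^sup>2" by (simp add: power2_eq_square flip: exp_add)
  finally show ?thesis
    by (simp add: potential_def smoothing_def n[symmetric] H_def power_mult_distrib power2_eq_square mult_ac)
qed

lemma exp_diff_le_pairpot:
  assumes "i \<in> I" "j \<in> I"
  shows "exp (g * (y i - y j)) \<le> n\<^sup>2 * pairpot g I y"
proof -
  have "exp (c * y k) \<le> expsum c I y" if "k \<in> I" for c k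
    unfolding expsum_def using fin that by (intro member_le_sum) auto
  then have "exp (g * y i) * exp (- g * y j) \<le> expsum g I y * expsum (- g) I y"
    using assms by (intro mult_mono less_imp_le[OF expsum_pos] exp_ge_zero) blast+
  then show ?thesis
    using npos by (simp add: pairpot_def n[symmetric] right_diff_distrib flip: exp_add)
qed

section \<open>Exponential moments of the potential under a bounded spread\<close>

lemma pairpot_le_spread:
  assumes s: "\<And>i j. i \<in> I \<Longrightarrow> j \<in> I \<Longrightarrow> y i - y j \<le> s"
  shows "pairpot g I y \<le> exp (g * s)"
proof -
  have "expsum g I y * expsum (- g) I y = (\<Sum>i\<in>I. \<Sum>j\<in>I. exp (g * (y i - y j)))"
    by (simp add: expsum_def sum_product algebra_simps flip: exp_add)
  also have "\<dots> \<le> (\<Sum>i\<in>I. \<Sum>j\<in>I. exp (g * s))"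
    using s g by (intro sum_mono) auto
  also have "\<dots> = n\<^sup>2 * exp (g * s)" using n by (simp add: power2_eq_square)
  finally show ?thesis using npos by (simp add: pairpot_def n[symmetric] divide_le_eq mult.commute)
qed

lemma share_le_spread:
  assumes s: "\<And>i j. i \<in> I \<Longrightarrow> j \<in> I \<Longrightarrow> y i - y j \<le> s" and i: "i \<in> I"
  shows "\<alpha> i \<le> exp (g * s) / n" "\<beta> i \<le> exp (g * s) / n"
proof -
  have "(\<Sum>j\<in>I. exp (g * y i)) \<le> (\<Sum>j\<in>I. exp (g * s) * exp (g * y j))"
  proof (rule sum_mono)
    fix j assume "j \<in> I"
    then have "g * (y i - y j) \<le> g * s" using s i g by (intro mult_left_mono) auto
    then show "exp (g * y i) \<le> exp (g * s) * exp (g * y j)" by (simp add: algebra_simps flip: exp_add)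
  qed
  then have "n * exp (g * y i) \<le> exp (g * s) * expsum g I y" using n by (simp add: expsum_def sum_distrib_left)
  then show "\<alpha> i \<le> exp (g * s) / n" using npos expsum_pos[of g y] by (simp add: \<alpha>_def field_simps)
  have "(\<Sum>j\<in>I. exp (- g * y i)) \<le> (\<Sum>j\<in>I. exp (g * s) * exp (- g * y j))"
  proof (rule sum_mono)
    fix j assume "j \<in> I"
    then have "g * (y j - y i) \<le> g * s" using s i g by (intro mult_left_mono) auto
    then show "exp (- g * y i) \<le> exp (g * s) * exp (- g * y j)" by (simp add: algebra_simps flip: exp_add)
  qed
  then have "n * exp (- g * y i) \<le> exp (g * s) * expsum (- g) I y" using n by (simp add: expsum_def sum_distrib_left)
  then show "\<beta> i \<le> exp (g * s) / n" using npos expsum_pos[of "- g" y] by (simp add: \<beta>_def field_simps)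
qed

text \<open>With a bounded spread no bin has a share above \<open>exp (g * s) / n\<close> in either
  sum, so the factors of one step are all close to 1.\<close>

lemma ratio_spread:
  assumes s: "\<And>i j. i \<in> I \<Longrightarrow> j \<in> I \<Longrightarrow> y i - y j \<le> s" and i: "i \<in> I"
  shows "\<bar>ratio i - 1\<bar> \<le> 10 * g * exp (g * s) / n"
proof -
  let ?J = "exp (g * s) / n"
  let ?u = "(exp g - 1) * \<alpha> i" and ?v = "(1 - exp (- g)) * \<beta> i"
  let ?Q = "(1 + ?u) * (1 - ?v)"
  note sh = shares(1,2)[of i] share_le_1[OF i] share_le_spread[OF s i]
  have s0: "0 \<le> s" using s[OF i i] by simp
  have J0: "1 / n \<le> ?J" using s0 g npos by (intro divide_right_mono) auto
  have gg: "g\<^sup>2 \<le> g" using g g_small by (simp add: power2_eq_square mult_left_le)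
  have gJ: "0 \<le> g * ?J" using g npos by simp
  have u: "0 \<le> ?u" using exp_g g sh by (intro mult_nonneg_nonneg) auto
  have "?u \<le> (2 * g) * ?J" using exp_g gg sh g by (intro mult_mono) auto
  then have u2: "?u \<le> 2 * (g * ?J)" by (simp only: mult.assoc)
  have v: "0 \<le> ?v" using exp_g g sh by (intro mult_nonneg_nonneg) auto
  have v2: "?v \<le> g * ?J" using exp_g sh g by (intro mult_mono) auto
  have "?v \<le> g * 1" using exp_g sh g by (intro mult_mono) auto
  then have v3: "?v \<le> 1" using g_small by simp
  have uv: "0 \<le> ?u * ?v" "?u * ?v \<le> ?u" using u v v3 by (auto simp: mult_left_le)
  have "?u \<le> (2 * g) * 1" using exp_g gg sh g by (intro mult_mono) auto
  then have u3: "?u \<le> 1" using g_small by simp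
  have Qe: "?Q = 1 + ?u - ?v - ?u * ?v" by (simp add: algebra_simps)
  have Q1: "\<bar>?Q - 1\<bar> \<le> 3 * (g * ?J)" unfolding Qe using uv u u2 v v2 gJ by linarith
  have Q2: "0 \<le> ?Q" "?Q \<le> 2" using u u3 v v3 uv Qe by (auto intro!: mult_nonneg_nonneg)
  have W: "\<bar>w i\<bar> \<le> g / (16 * n)" by (rule abs_w_le[OF i])
  have gn: "g / (16 * n) \<le> g / 16" using n2 g by (intro divide_left_mono) auto
  have E: "\<bar>exp (- w i) - 1\<bar> \<le> 2 * \<bar>w i\<bar>"
  proof -
    have a: "\<bar>w i\<bar> \<le> 1/2" using W gn g_small by linarith
    have "\<bar>w i\<bar> * \<bar>w i\<bar> \<le> \<bar>w i\<bar> * 1" using a by (intro mult_left_mono) auto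
    then have "(w i)\<^sup>2 \<le> \<bar>w i\<bar>" by (simp add: power2_eq_square)
    then show ?thesis using exp_minus_le_quadratic[OF a] exp_ge_add_one_self[of "- w i"] by linarith
  qed
  have "g / (16 * n) = g * (1 / n) / 16" by simp
  also have "\<dots> \<le> g * ?J / 16" using mult_left_mono[OF J0, of g] g by (intro divide_right_mono) auto
  finally have gJ16: "g / (16 * n) \<le> g * ?J / 16" .
  have E2: "\<bar>exp (- w i) - 1\<bar> \<le> g * ?J / 8"
  proof -
    have "x \<le> 2 * v \<Longrightarrow> v \<le> u \<Longrightarrow> u \<le> t / 16 \<Longrightarrow> x \<le> t / 8" for x v u t :: real by linarith
    then show ?thesis using E W gJ16 by blast
  qed
  have "ratio i - 1 = ?Q * (exp (- w i) - 1) + (?Q - 1)" by (simp add: ratio_def algebra_simps)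
  then have "\<bar>ratio i - 1\<bar> \<le> \<bar>?Q * (exp (- w i) - 1)\<bar> + \<bar>?Q - 1\<bar>" by linarith
  also have "\<bar>?Q * (exp (- w i) - 1)\<bar> \<le> 2 * (g * ?J / 8)"
    unfolding abs_mult using Q2 E2 by (intro mult_mono) auto
  finally have r: "\<bar>ratio i - 1\<bar> \<le> 2 * (g * ?J / 8) + \<bar>?Q - 1\<bar>" by simp
  have "x \<le> 2 * (t / 8) + q \<Longrightarrow> q \<le> 3 * t \<Longrightarrow> 0 \<le> t \<Longrightarrow> x \<le> 10 * t" for x q t :: real by linarith
  from this[OF r Q1 gJ] show ?thesis by (simp add: mult.assoc)
qed

text \<open>The quadratic term in the expansion of \<open>exp\<close> must stay below half of the
  drift. A step has relative size at most \<open>10 * g * exp (g * s) / n\<close>; its square, times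
  a potential of at most \<open>exp (g * s)\<close>, explains the third power in the
  hypothesis.\<close>

lemma exp_potential_drift:
  assumes s: "\<And>i j. i \<in> I \<Longrightarrow> j \<in> I \<Longrightarrow> y i - y j \<le> s"
    and \<theta>: "1 \<le> \<theta>" "200 * \<theta> * exp (3 * (g * s)) \<le> n"
  shows "(\<Sum>i\<in>I. p i * exp (\<theta> * potential g I (move I i y)))
    \<le> (1 - g\<^sup>2 / (2 * n)) * exp (\<theta> * potential g I y) + exp (25 * \<theta> + 1)"
proof -
  let ?X = "potential g I y" and ?E = "exp (g * s)"
  let ?J = "10 * g * ?E / n"
  obtain i0 where "i0 \<in> I" using ne by auto
  then have s0: "0 \<le> s" using s[of i0 i0] by simp
  then have E1: "1 \<le> ?E" using g by simp
  have E3: "exp (3 * (g * s)) = ?E ^ 3" by (simp add: exp_of_nat_mult[symmetric])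
  have X: "0 < ?X" "?X \<le> ?E" using potential_pos potential_le_pairpot pairpot_le_spread[OF s] by auto
  have tX: "\<theta> * ?X * (?E\<^sup>2 * 200) \<le> n"
  proof -
    have "\<theta> * ?X * (?E\<^sup>2 * 200) \<le> \<theta> * ?E * (?E\<^sup>2 * 200)" using X \<theta> by (intro mult_right_mono mult_left_mono) auto
    also have "\<dots> = 200 * \<theta> * ?E ^ 3" by (simp add: power2_eq_square power3_eq_cube)
    also have "\<dots> \<le> n" using \<theta>(2) unfolding E3 .
    finally show ?thesis .
  qed
  have tX2: "\<theta> * ?X * ?J\<^sup>2 \<le> g\<^sup>2 / (2 * n)"
  proof -
    have "\<theta> * ?X * ?J\<^sup>2 = (\<theta> * ?X * (?E\<^sup>2 * 200)) * (g\<^sup>2 / (2 * n\<^sup>2))"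
      using npos by (simp add: power2_eq_square field_simps)
    also have "\<dots> \<le> n * (g\<^sup>2 / (2 * n\<^sup>2))" using tX by (intro mult_right_mono) auto
    also have "\<dots> = g\<^sup>2 / (2 * n)" using npos by (simp add: power2_eq_square)
    finally show ?thesis .
  qed
  have tX1: "\<theta> * ?X * ?J \<le> 1/2"
  proof -
    have "\<theta> * ?X * ?J = (\<theta> * ?X * (?E * 200)) * (g / (20 * n))"
      using npos by (simp add: field_simps)
    also have "\<dots> \<le> n * (g / (20 * n))"
    proof (rule mult_right_mono)
      have "?E * 1 \<le> ?E * ?E" using E1 by (intro mult_left_mono) auto
      then have "\<theta> * ?X * (?E * 200) \<le> \<theta> * ?X * (?E\<^sup>2 * 200)"
        using X \<theta> by (intro mult_left_mono) (auto simp: power2_eq_square)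
      then show "\<theta> * ?X * (?E * 200) \<le> n" using tX by linarith
    qed (use g npos in auto)
    also have "\<dots> \<le> 1/2" using npos g_small by simp
    finally show ?thesis .
  qed
  let ?d = "\<lambda>i. \<theta> * ?X * (ratio i - 1)"
  have dJ: "\<bar>?d i\<bar> \<le> \<theta> * ?X * ?J" if "i \<in> I" for i
    unfolding abs_mult using X \<theta> ratio_spread[OF s that] by (intro mult_mono) auto
  have move: "exp (\<theta> * potential g I (move I i y)) = exp (\<theta> * ?X) * exp (?d i)" if "i \<in> I" for i
    unfolding potential_move[OF that] by (simp add: algebra_simps flip: exp_add)
  show ?thesis
  proof (cases "25 \<le> pairpot g I y")
    case True
    then have "25 \<le> 2 * ?X\<^sup>2" using pairpot_le_potential by linarith
    \<comment> \<open>The relative drift is proportional to \<open>\<theta> * ?X\<close>, so a lower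
      bound on the potential itself is needed, not only on \<open>pairpot\<close>.\<close>
    have X1: "1 \<le> ?X"
    proof (rule ccontr)
      assume "\<not> 1 \<le> ?X"
      then have "?X\<^sup>2 \<le> 1" using X by (intro power_le_one) auto
      with \<open>25 \<le> 2 * ?X\<^sup>2\<close> show False by linarith
    qed
    have "(\<Sum>i\<in>I. p i * exp (\<theta> * potential g I (move I i y)))
      = exp (\<theta> * ?X) * (\<Sum>i\<in>I. p i * exp (?d i))"
      unfolding sum_distrib_left by (intro sum.cong refl) (simp add: move)
    also have "\<dots> \<le> exp (\<theta> * ?X) * (1 - g\<^sup>2 / (2 * n))"
    proof (rule mult_left_mono)
      have "(\<Sum>i\<in>I. p i * exp (?d i)) \<le> (\<Sum>i\<in>I. p i * (1 + \<theta> * ?X * (ratio i - 1) + (\<theta> * ?X * ?J)\<^sup>2))"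
      proof (intro sum_mono mult_left_mono p_nonneg)
        fix i assume i: "i \<in> I"
        have "exp (- (- ?d i)) \<le> 1 - (- ?d i) + (- ?d i)\<^sup>2"
          using dJ[OF i] tX1 by (intro exp_minus_le_quadratic) auto
        moreover have "(?d i)\<^sup>2 \<le> (\<theta> * ?X * ?J)\<^sup>2"
          using dJ[OF i] by (metis abs_ge_zero power2_abs power_mono)
        ultimately show "exp (?d i) \<le> 1 + \<theta> * ?X * (ratio i - 1) + (\<theta> * ?X * ?J)\<^sup>2" by simp
      qed
      also have "\<dots> = (\<Sum>i\<in>I. p i * (1 - \<theta> * ?X + (\<theta> * ?X * ?J)\<^sup>2) + \<theta> * ?X * (p i * ratio i))"
        by (intro sum.cong refl) (simp add: algebra_simps)
      also have "\<dots> = 1 - \<theta> * ?X + (\<theta> * ?X * ?J)\<^sup>2 + \<theta> * ?X * (\<Sum>i\<in>I. p i * ratio i)"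
        by (simp only: sum.distrib sum_p_const sum_distrib_left)
      also have "\<dots> \<le> 1 - \<theta> * ?X + (\<theta> * ?X) * (g\<^sup>2 / (2 * n)) + \<theta> * ?X * (1 - g\<^sup>2 / n)"
      proof (intro add_mono mult_left_mono mean_ratio_large[OF True] order_refl)
        have "(\<theta> * ?X * ?J)\<^sup>2 = (\<theta> * ?X) * (\<theta> * ?X * ?J\<^sup>2)" by (simp add: power2_eq_square)
        also have "\<dots> \<le> (\<theta> * ?X) * (g\<^sup>2 / (2 * n))" using tX2 X \<theta> by (intro mult_left_mono) auto
        finally show "(\<theta> * ?X * ?J)\<^sup>2 \<le> (\<theta> * ?X) * (g\<^sup>2 / (2 * n))" .
      qed (use X \<theta> in auto)
      also have "\<dots> = 1 - (\<theta> * ?X) * (g\<^sup>2 / (2 * n))"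
        using npos by (simp add: field_simps)
      also have "\<dots> \<le> 1 - 1 * (g\<^sup>2 / (2 * n))"
        using X1 \<theta> npos mult_mono[of 1 \<theta> 1 ?X] by (intro diff_left_mono mult_right_mono) auto
      finally show "(\<Sum>i\<in>I. p i * exp (?d i)) \<le> 1 - g\<^sup>2 / (2 * n)" by simp
    qed auto
    finally show ?thesis by (simp add: mult.commute add_increasing2)
  next
    case False
    then have X25: "?X \<le> 25" using potential_le_pairpot by linarith
    have "(\<Sum>i\<in>I. p i * exp (\<theta> * potential g I (move I i y))) \<le> (\<Sum>i\<in>I. p i * exp (25 * \<theta> + 1))"
    proof (intro sum_mono mult_left_mono p_nonneg)
      fix i assume i: "i \<in> I"
      have "\<theta> * ?X \<le> \<theta> * 25" using X25 \<theta> by (intro mult_left_mono) auto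
      then show "exp (\<theta> * potential g I (move I i y)) \<le> exp (25 * \<theta> + 1)"
        unfolding move[OF i] using dJ[OF i] tX1 by (simp flip: exp_add)
    qed
    also have "\<dots> = exp (25 * \<theta> + 1)" by (rule sum_p_const)
    finally have 1: "(\<Sum>i\<in>I. p i * exp (\<theta> * potential g I (move I i y))) \<le> exp (25 * \<theta> + 1)" .
    have "g\<^sup>2 / (2 * n) \<le> 1" 
    proof -
      have "g\<^sup>2 \<le> 1" using g g_small by (simp add: power_le_one)
      then show ?thesis using n2 by simp
    qed
    then have "0 \<le> (1 - g\<^sup>2 / (2 * n)) * exp (\<theta> * ?X)" by (intro mult_nonneg_nonneg) auto
    then show ?thesis using 1 by linarith
  qed
qed

text \<open>
  The heavy bins carry a total load of at least \<open>\<delta> * n * f\<close>, which the light bins have to compensate.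
\<close>

lemma light_frac_ge:
  assumes "1/2 \<le> \<delta>"
  shows "(g * f)\<^sup>2 \<le> 4 * \<eta> * pairpot g I y"
proof -
  have "(\<Sum>i\<in>I. g * (f - y i)) = g * f * n"
    using sum0 n by (simp add: sum_subtractf sum_distrib_left[symmetric])
  moreover have "(\<Sum>i\<in>heavy. g * (f - y i)) \<le> 0"
    using g by (intro sum_nonpos) (auto simp: heavy_def mult_le_0_iff)
  ultimately have 1: "g * f * n \<le> (\<Sum>i\<in>light. g * (f - y i))" using sum_parts[of "\<lambda>i. g * (f - y i)"] by linarith
  have "(\<Sum>i\<in>light. (g * (f - y i))\<^sup>2) \<le> (\<Sum>i\<in>light. 2 * exp (- g * (y i - f)))"
  proof (rule sum_mono)
    fix i assume "i \<in> light"
    then have "0 \<le> g * (f - y i)" using g by (simp add: light_def)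
    from exp_lower_Taylor_quadratic[OF this] this
    have "(g * (f - y i))\<^sup>2 \<le> 2 * exp (g * (f - y i))" by simp
    then show "(g * (f - y i))\<^sup>2 \<le> 2 * exp (- g * (y i - f))" by (simp add: algebra_simps)
  qed
  also have "\<dots> = 2 * (light_weight * n)" using npos by (simp add: light_weight_def sum_distrib_left)
  finally have 2: "(\<Sum>i\<in>light. (g * (f - y i))\<^sup>2) \<le> 2 * (light_weight * n)" .
  \<comment> \<open>Cauchy-Schwarz over the light bins makes their number appear as a
    factor.\<close>
  have "(g * f * n)\<^sup>2 \<le> (\<Sum>i\<in>light. g * (f - y i))\<^sup>2"
    using 1 g f npos by (intro power_mono) auto
  also have "\<dots> \<le> (\<eta> * n) * (\<Sum>i\<in>light. (g * (f - y i))\<^sup>2)"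
    using sum_squared_le_sum_of_squares[of "\<lambda>i. g * (f - y i)" light] card_parts parts by (simp add: mult.commute)
  also have "\<dots> \<le> (\<eta> * n) * (2 * (light_weight * n))" using 2 frac npos by (intro mult_left_mono) auto
  finally have "(g * f)\<^sup>2 * n\<^sup>2 \<le> (2 * \<eta> * light_weight) * n\<^sup>2" by (simp add: power_mult_distrib power2_eq_square mult_ac)
  then have 3: "(g * f)\<^sup>2 \<le> 2 * \<eta> * light_weight" using npos by simp
  have h: "\<delta> * n * exp (g * f) \<le> expsum g I y"
  proof -
    have "\<delta> * n * exp (g * f) = (\<Sum>i\<in>heavy. exp (g * f))" by (simp add: card_parts)
    also have "\<dots> \<le> (\<Sum>i\<in>heavy. exp (g * y i))" using g by (intro sum_mono) (auto simp: heavy_def)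
    also have "\<dots> \<le> expsum g I y" unfolding expsum_def using fin by (intro sum_mono2) (auto simp: heavy_def)
    finally show ?thesis .
  qed
  have l: "light_weight * n * exp (- g * f) \<le> expsum (- g) I y"
  proof -
    have "light_weight * n * exp (- g * f) = (\<Sum>i\<in>light. exp (- g * (y i - f)) * exp (- g * f))"
      unfolding sum_distrib_right[symmetric] using npos by (simp add: light_weight_def)
    also have "\<dots> = (\<Sum>i\<in>light. exp (- g * y i))" by (intro sum.cong refl) (simp add: algebra_simps flip: exp_add)
    also have "\<dots> \<le> expsum (- g) I y" unfolding expsum_def using fin by (intro sum_mono2) (auto simp: light_def)
    finally show ?thesis .
  qed
  have l0: "0 \<le> light_weight" using npos by (auto simp: light_weight_def intro!: divide_nonneg_pos sum_nonneg)
  \<comment> \<open>The heavy part of one sum times the light part of the other is a lower bound for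
    the product; as \<open>\<delta> \<ge> 1/2\<close>, it bounds
    \<open>light_weight\<close>.\<close>
  have "(\<delta> * n * exp (g * f)) * (light_weight * n * exp (- g * f)) \<le> expsum g I y * expsum (- g) I y"
    using h l l0 npos frac expsum_pos[of g y] by (intro mult_mono mult_nonneg_nonneg) auto
  also have "(\<delta> * n * exp (g * f)) * (light_weight * n * exp (- g * f)) = \<delta> * light_weight * n\<^sup>2 * (exp (g * f) * exp (- g * f))"
    by (simp add: power2_eq_square mult_ac)
  also have "exp (g * f) * exp (- g * f) = 1" by (simp flip: exp_add)
  finally have "\<delta> * light_weight \<le> pairpot g I y" using npos by (simp add: pairpot_def n[symmetric] pos_le_divide_eq)
  moreover have "1/2 * light_weight \<le> \<delta> * light_weight" using assms l0 by (intro mult_right_mono) auto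
  ultimately have "light_weight \<le> 2 * pairpot g I y" by simp
  then have "2 * \<eta> * light_weight \<le> 2 * \<eta> * (2 * pairpot g I y)" using frac by (intro mult_left_mono) auto
  then show ?thesis using 3 by simp
qed

section \<open>Contraction of the overload\<close>

lemma light_frac_ge_inverse: "f > 0 \<Longrightarrow> 1 / n \<le> \<eta>"
proof -
  assume f0: "f > 0"
  have "light \<noteq> {}"
  proof
    assume "light = {}"
    then have "(\<Sum>i\<in>I. f) \<le> sum y I" using parts by (intro sum_mono) (auto simp: light_def)
    then show False using sum0 f0 n npos by (simp add: mult_le_0_iff)
  qed
  then have "1 \<le> card light" using parts by (simp add: Suc_leI card_gt_0_iff)
  then show ?thesis using card_parts(2) npos by (simp add: divide_le_eq)
qed

text \<open>A heavy bin receives the ball with probability \<open>\<delta> / n\<close> only, while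
  recentering lowers it by \<open>1 / n\<close>. The condition \<open>a \<le> \<epsilon> / 4\<close>
  keeps the second order of \<open>exp a\<close> below a quarter of the difference
  \<open>a * \<epsilon>\<close>. The extra balls for light bins cost a constant, as their terms are
  at most 1.\<close>

lemma overload_drift:
  assumes a: "0 < a" "a \<le> \<epsilon> / 4" "\<epsilon> \<le> \<eta>"
  shows "(\<Sum>i\<in>I. p i * overload a f I (move I i y)) \<le> (1 - a * \<epsilon> / (2 * n)) * overload a f I y + 2 * a"
proof -
  let ?V = "overload a f I y" and ?v = "\<lambda>i. exp (a * (y i - f))"
  have V0: "0 \<le> ?V" unfolding overload_def by (intro sum_nonneg) auto
  have ov: "overload a f I z = exp (- a * f) * expsum a I z" for z
    by (simp add: overload_def expsum_def sum_distrib_left algebra_simps flip: exp_add)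
  have e1: "\<epsilon> \<le> 1" using a frac by linarith
  have a2: "a \<le> 1/4" using a e1 by linarith
  have ring: "q * (e * (V + c * v)) = q * (e * V) + e * c * (q * v)" for q e V c v :: real
    by (simp add: algebra_simps)
  have mv: "overload a f I (move I i y) = exp (- a / n) * (?V + (exp a - 1) * ?v i)" if "i \<in> I" for i
    unfolding ov expsum_move[OF that] by (simp add: algebra_simps flip: exp_add)
  have e0: "0 < \<epsilon>" using a by linarith
  have ea: "exp a - 1 \<le> a + a\<^sup>2" using exp_bound[of a] a a2 by simp
  have aa: "a\<^sup>2 \<le> a * (\<epsilon> / 4)" using a by (simp add: power2_eq_square)
  have grow: "exp a - 1 \<le> 2 * a"
  proof -
    have "a * a \<le> a * 1" using a a2 by (intro mult_left_mono) auto
    then show ?thesis using ea by (simp add: power2_eq_square)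
  qed
  have "(exp a - 1) * \<delta> \<le> (a + a\<^sup>2) * (1 - \<epsilon>)" using ea a frac by (intro mult_mono) auto
  also have "\<dots> = a - a * \<epsilon> + a\<^sup>2 - a\<^sup>2 * \<epsilon>" by (simp add: algebra_simps)
  also have "\<dots> \<le> a - a * \<epsilon> * 3 / 4"
  proof -
    have "0 \<le> a\<^sup>2 * \<epsilon>" using e0 by simp
    then show ?thesis using aa by simp
  qed
  finally have k: "(exp a - 1) * \<delta> \<le> a - a * \<epsilon> * 3 / 4" .
  have "exp (- a / n) * (1 + (exp a - 1) * \<delta> / n) \<le> exp (- a / n) * exp ((exp a - 1) * \<delta> / n)"
    by (intro mult_left_mono exp_ge_add_one_self) auto
  also have "\<dots> = exp ((- a + (exp a - 1) * \<delta>) / n)" by (simp add: diff_divide_distrib flip: exp_add)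
  also have "\<dots> \<le> exp (- (a * \<epsilon> * 3 / 4 / n))"
  proof -
    have "- a + (exp a - 1) * \<delta> \<le> - (a * \<epsilon> * 3 / 4)" using k by simp
    then have "(- a + (exp a - 1) * \<delta>) / n \<le> - (a * \<epsilon> * 3 / 4) / n" by (rule divide_right_mono) (use npos in simp)
    then show ?thesis by simp
  qed
  also have "\<dots> \<le> 1 - a * \<epsilon> / (2 * n)"
  proof -
    define q where "q = a * \<epsilon> / n"
    have "a * \<epsilon> \<le> 1/4 * 1" using a a2 e1 e0 by (intro mult_mono) auto
    then have "a * \<epsilon> \<le> 1/4 * n" using n2 by simp
    then have q: "0 \<le> q" "q \<le> 1/4" using a e0 npos by (simp_all add: q_def divide_le_eq)
    have w2: "(q * 3 / 4)\<^sup>2 \<le> q / 4"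
    proof -
      have "q * q \<le> q * (1/4)" by (rule mult_left_mono[OF q(2,1)])
      moreover have "(q * 3 / 4)\<^sup>2 = q * q * (9 / 16)" by (simp add: power2_eq_square)
      ultimately show ?thesis using q(1) by simp
    qed
    have "exp (- (q * 3 / 4)) \<le> 1 - q * 3 / 4 + (q * 3 / 4)\<^sup>2" using q by (intro exp_minus_le_quadratic) auto
    with w2 have "exp (- (q * 3 / 4)) \<le> 1 - q / 2" by simp
    then show ?thesis by (simp add: q_def mult.commute)
  qed
  finally have contr: "exp (- a / n) * (1 + (exp a - 1) * \<delta> / n) \<le> 1 - a * \<epsilon> / (2 * n)" .
  have add: "exp (- a / n) * (exp a - 1) \<le> 1 * (2 * a)"
    using grow a npos by (intro mult_mono) auto
  have "(\<Sum>i\<in>I. p i * overload a f I (move I i y)) = (\<Sum>i\<in>I. p i * (exp (- a / n) * ?V) + exp (- a / n) * (exp a - 1) * (p i * ?v i))"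
    by (intro sum.cong refl) (simp only: mv ring)
  also have "\<dots> = exp (- a / n) * (?V + (exp a - 1) * (\<Sum>i\<in>I. p i * ?v i))"
    by (simp only: sum.distrib sum_p_const sum_distrib_left[symmetric]) (simp add: algebra_simps)
  also have "\<dots> \<le> exp (- a / n) * (?V + (exp a - 1) * ((\<delta> * ?V + n) / n))"
  proof -
    have "sum ?v light \<le> real (card light)"
      using a(1) sum_bounded_above[of light ?v 1] by (auto simp: light_def mult_le_0_iff)
    also have "\<dots> \<le> n" using fin n by (simp add: light_def card_mono)
    finally have "(\<Sum>i\<in>I. p i * ?v i) \<le> (\<delta> * ?V + n) / n"
      unfolding sum_p using npos by (simp add: overload_def divide_right_mono)
    then show ?thesis using a by (intro mult_left_mono add_left_mono) auto
  qed
  also have "\<dots> = exp (- a / n) * (1 + (exp a - 1) * \<delta> / n) * ?V + exp (- a / n) * (exp a - 1)"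
    using npos by (simp add: field_simps)
  also have "\<dots> \<le> (1 - a * \<epsilon> / (2 * n)) * ?V + 1 * (2 * a)"
    by (rule add_mono[OF mult_right_mono[OF contr V0] add])
  finally show ?thesis by simp
qed

end

subsection \<open>Drift in finitely supported Markov chains\<close>

lemma expectation_pmf_mono:
  fixes h k :: "'a \<Rightarrow> real"
  assumes "finite (set_pmf M)" "\<And>x. x \<in> set_pmf M \<Longrightarrow> h x \<le> k x"
  shows "measure_pmf.expectation M h \<le> measure_pmf.expectation M k"
  using assms by (intro integral_mono_AE integrable_measure_pmf_finite) (auto simp: AE_measure_pmf_iff)

lemma expectation_pmf_bind:
  fixes h :: "'b \<Rightarrow> real"
  assumes "finite (set_pmf M)" "\<And>x. x \<in> set_pmf M \<Longrightarrow> finite (set_pmf (K x))"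
  shows "measure_pmf.expectation (M \<bind> K) h = measure_pmf.expectation M (\<lambda>x. measure_pmf.expectation (K x) h)"
  using assms by (simp add: pmf_expectation_bind[of "set_pmf M"] integral_measure_pmf[of "set_pmf M"])

lemma expectation_pmf_affine:
  fixes h :: "'b \<Rightarrow> real"
  assumes "finite (set_pmf M)"
  shows "measure_pmf.expectation M (\<lambda>x. c * h x + d) = c * measure_pmf.expectation M h + d"
  using assms by (simp add: integrable_measure_pmf_finite)

lemma prob_pmf_mono:
  assumes "finite (set_pmf M)" "\<And>x. x \<in> set_pmf M \<Longrightarrow> x \<in> A \<Longrightarrow> x \<in> B"
  shows "measure_pmf.prob M A \<le> measure_pmf.prob M B"
  using expectation_pmf_mono[of M "indicator A" "indicator B"] assms by (auto simp: indicator_def)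

locale finite_chain =
  fixes \<mu> :: "nat \<Rightarrow> 'a pmf" and K :: "nat \<Rightarrow> 'a \<Rightarrow> 'a pmf"
  assumes step: "\<mu> (Suc t) = \<mu> t \<bind> K t"
    and fin: "finite (set_pmf (\<mu> t))"
begin

lemma fin_K: "x \<in> set_pmf (\<mu> t) \<Longrightarrow> finite (set_pmf (K t x))"
  using fin[of "Suc t"] unfolding step by (rule rev_finite_subset) auto

lemma expectation_Suc:
  fixes h :: "'a \<Rightarrow> real"
  shows "measure_pmf.expectation (\<mu> (Suc t)) h = measure_pmf.expectation (\<mu> t) (\<lambda>x. measure_pmf.expectation (K t x) h)"
  unfolding step by (rule expectation_pmf_bind[OF fin fin_K])

lemma expectation_drift:
  fixes U :: "nat \<Rightarrow> 'a \<Rightarrow> real"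
  assumes drift: "\<And>t x. x \<in> set_pmf (\<mu> t) \<Longrightarrow>
      measure_pmf.expectation (K t x) (U (Suc t)) \<le> (1 - r) * U t x + a"
    and r: "0 < r" "r \<le> 1" and U0: "\<And>x. x \<in> set_pmf (\<mu> 0) \<Longrightarrow> U 0 x \<le> b" and b: "a / r \<le> b"
  shows "measure_pmf.expectation (\<mu> t) (U t) \<le> b"
proof (induction t)
  case 0
  then show ?case using expectation_pmf_mono[OF fin U0] by simp
next
  case (Suc t)
  have "measure_pmf.expectation (\<mu> (Suc t)) (U (Suc t)) \<le> measure_pmf.expectation (\<mu> t) (\<lambda>x. (1 - r) * U t x + a)"
    unfolding expectation_Suc by (intro expectation_pmf_mono fin drift)
  also have "\<dots> = (1 - r) * measure_pmf.expectation (\<mu> t) (U t) + a"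
    by (rule expectation_pmf_affine[OF fin])
  also have "\<dots> \<le> (1 - r) * b + b * r"
    using Suc r b by (intro add_mono mult_left_mono) (auto simp: pos_divide_le_eq)
  finally show ?case by (simp add: algebra_simps)
qed

text \<open>
  The truncation at 1 absorbs the states outside of \<open>G\<close>, where no drift is available.
\<close>

lemma prob_drift:
  fixes U :: "nat \<Rightarrow> 'a \<Rightarrow> real"
  assumes drift: "\<And>t x. x \<in> set_pmf (\<mu> t) \<Longrightarrow> x \<in> G t \<Longrightarrow>
      measure_pmf.expectation (K t x) (U (Suc t)) \<le> (1 - r) * U t x + a"
    and U: "\<And>t x. 0 \<le> U t x" and r: "0 < r" "r \<le> 1" and a: "0 \<le> a" and lam: "0 < lam"
  shows "measure_pmf.prob (\<mu> (s + k)) {x. lam < U (s + k) x}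
    \<le> measure_pmf.expectation (\<mu> s) (\<lambda>x. min 1 (((1 - r) ^ k * U s x + (1 - (1 - r) ^ k) * (a / r)) / lam))
      + (\<Sum>j<k. measure_pmf.prob (\<mu> (s + j)) {x. x \<notin> G (s + j)})"
proof (induction k arbitrary: s)
  case 0
  have "measure_pmf.expectation (\<mu> s) (indicator {x. lam < U s x}) \<le> measure_pmf.expectation (\<mu> s) (\<lambda>x. min 1 (U s x / lam))"
    using U lam by (intro expectation_pmf_mono fin) (auto simp: indicator_def)
  then show ?case by simp
next
  case (Suc k)
  define A where "A j = (1 - (1 - r) ^ j) * (a / r)" for j
  define h where "h j t x = ((1 - r) ^ j * U t x + A j) / lam" for j t x
  have A0: "0 \<le> A j" for j unfolding A_def using r a by (intro mult_nonneg_nonneg) (auto intro: power_le_one)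
  have h0: "0 \<le> h j t x" for j t x unfolding h_def using r a A0 U lam by (intro divide_nonneg_pos add_nonneg_nonneg mult_nonneg_nonneg) auto
  \<comment> \<open>The induction peels off the first round: the drift turns the bound
    \<open>h k\<close> at time \<open>Suc s\<close> into \<open>h (Suc k)\<close> at time
    \<open>s\<close>, and a state outside \<open>G s\<close> is charged the full probability
    1.\<close>
  have inner: "measure_pmf.expectation (K s x) (\<lambda>z. min 1 (h k (Suc s) z)) \<le> min 1 (h (Suc k) s x) + indicator {x. x \<notin> G s} x"
    if x: "x \<in> set_pmf (\<mu> s)" for x
  proof -
    have f: "finite (set_pmf (K s x))" using fin_K[OF x] .
    have le1: "measure_pmf.expectation (K s x) (\<lambda>z. min 1 (h k (Suc s) z)) \<le> 1"
      using expectation_pmf_mono[OF f, of "\<lambda>z. min 1 (h k (Suc s) z)" "\<lambda>_. 1"] by simp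
    show ?thesis
    proof (cases "x \<in> G s")
      case False
      then show ?thesis using le1 h0[of "Suc k" s x] by (auto simp: min_def)
    next
      case True
      have "measure_pmf.expectation (K s x) (\<lambda>z. min 1 (h k (Suc s) z)) \<le> measure_pmf.expectation (K s x) (\<lambda>z. h k (Suc s) z)"
        by (intro expectation_pmf_mono f) auto
      also have "\<dots> = measure_pmf.expectation (K s x) (\<lambda>z. (1 - r) ^ k / lam * U (Suc s) z + A k / lam)"
        by (simp add: h_def add_divide_distrib)
      also have "\<dots> = (1 - r) ^ k / lam * measure_pmf.expectation (K s x) (U (Suc s)) + A k / lam"
        by (rule expectation_pmf_affine[OF f])
      also have "\<dots> \<le> (1 - r) ^ k / lam * ((1 - r) * U s x + a) + A k / lam"
        using drift[OF x True] r lam by (intro add_right_mono mult_left_mono) auto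
      also have "\<dots> = ((1 - r) ^ Suc k * U s x + ((1 - r) ^ k * a + A k)) / lam"
        by (simp add: add_divide_distrib diff_divide_distrib algebra_simps)
      also have "(1 - r) ^ k * a + A k = A (Suc k)"
        using r by (simp add: A_def field_simps)
      finally show ?thesis using le1 True by (simp add: h_def)
    qed
  qed
  have "measure_pmf.prob (\<mu> (s + Suc k)) {x. lam < U (s + Suc k) x}
      \<le> measure_pmf.expectation (\<mu> (Suc s)) (\<lambda>x. min 1 (h k (Suc s) x))
        + (\<Sum>j<k. measure_pmf.prob (\<mu> (Suc s + j)) {x. x \<notin> G (Suc s + j)})"
    using Suc[of "Suc s"] by (simp add: h_def A_def)
  also have "measure_pmf.expectation (\<mu> (Suc s)) (\<lambda>x. min 1 (h k (Suc s) x))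
      \<le> measure_pmf.expectation (\<mu> s) (\<lambda>x. min 1 (h (Suc k) s x) + indicator {x. x \<notin> G s} x)"
    unfolding expectation_Suc by (intro expectation_pmf_mono fin inner)
  also have "\<dots> = measure_pmf.expectation (\<mu> s) (\<lambda>x. min 1 (h (Suc k) s x)) + measure_pmf.prob (\<mu> s) {x. x \<notin> G s}"
    using fin by (subst Bochner_Integration.integral_add) (auto intro: integrable_measure_pmf_finite)
  finally show ?case
    by (simp add: h_def A_def sum.lessThan_Suc_shift add.assoc del: sum.lessThan_Suc power_Suc)
qed

text \<open>The bound is uniform in \<open>t\<close>, although failures of \<open>G\<close> may
  accumulate over a long run. Only the last \<open>T\<close> rounds are examined: the start of this
  window is in \<open>G\<close> up to probability \<open>p\<close>, there \<open>U\<close> is at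
  most \<open>B\<close>, and \<open>(1 - r) ^ T\<close> erases \<open>B\<close>. The factor
  \<open>T + 1\<close> counts the rounds of the window and its start.\<close>

lemma prob_drift_window:
  fixes U :: "nat \<Rightarrow> 'a \<Rightarrow> real"
  assumes drift: "\<And>t x. x \<in> set_pmf (\<mu> t) \<Longrightarrow> x \<in> G t \<Longrightarrow>
      measure_pmf.expectation (K t x) (U (Suc t)) \<le> (1 - r) * U t x + a"
    and U: "\<And>t x. 0 \<le> U t x" and r: "0 < r" "r \<le> 1" and a: "0 \<le> a" and lam: "0 < lam"
    and G: "\<And>t. measure_pmf.prob (\<mu> t) {x. x \<notin> G t} \<le> p"
    and B: "\<And>t x. x \<in> set_pmf (\<mu> t) \<Longrightarrow> x \<in> G t \<Longrightarrow> U t x \<le> B" and B0: "0 \<le> B"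
    and U0: "\<And>x. x \<in> set_pmf (\<mu> 0) \<Longrightarrow> U 0 x \<le> a / r"
  shows "measure_pmf.prob (\<mu> t) {x. lam < U t x} \<le> (real T + 1) * p + ((1 - r) ^ T * B + 2 * (a / r)) / lam"
proof -
  have p0: "0 \<le> p" using G[of 0] by (meson measure_nonneg order_trans)
  have ar: "0 \<le> a / r" using a r by simp
  have pw: "0 \<le> (1 - r) ^ k" "(1 - r) ^ k \<le> 1" for k using r by (auto intro: power_le_one)
  have sum_le: "(\<Sum>j<k. measure_pmf.prob (\<mu> (s + j)) {x. x \<notin> G (s + j)}) \<le> real k * p" for k s
    using sum_bounded_above[of "{..<k}" "\<lambda>j. measure_pmf.prob (\<mu> (s + j)) {x. x \<notin> G (s + j)}" p] G by simp
  have tail: "(1 - (1 - r) ^ k) * (a / r) \<le> a / r" for k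
    using pw ar by (intro mult_left_le_one_le) auto
  note pd = prob_drift[of G U, OF drift U r a lam]
  show ?thesis
  proof (cases "T \<le> t")
    case True
    then obtain s where t: "t = s + T" by (metis add.commute le_Suc_ex)
    let ?b = "((1 - r) ^ T * B + a / r) / lam"
    have b0: "0 \<le> ?b" using pw B0 ar lam by auto
    have "measure_pmf.expectation (\<mu> s) (\<lambda>x. min 1 (((1 - r) ^ T * U s x + (1 - (1 - r) ^ T) * (a / r)) / lam))
      \<le> measure_pmf.expectation (\<mu> s) (\<lambda>x. 1 * indicator {x. x \<notin> G s} x + ?b)"
    proof (rule expectation_pmf_mono[OF fin])
      fix x assume x: "x \<in> set_pmf (\<mu> s)"
      show "min 1 (((1 - r) ^ T * U s x + (1 - (1 - r) ^ T) * (a / r)) / lam) \<le> 1 * indicator {x. x \<notin> G s} x + ?b"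
      proof (cases "x \<in> G s")
        case True
        then have "((1 - r) ^ T * U s x + (1 - (1 - r) ^ T) * (a / r)) / lam \<le> ?b"
          using B[OF x True] pw tail lam by (intro divide_right_mono add_mono mult_left_mono) auto
        then show ?thesis using True by simp
      qed (use b0 in auto)
    qed
    also have "\<dots> = 1 * measure_pmf.expectation (\<mu> s) (indicator {x. x \<notin> G s}) + ?b"
      by (rule expectation_pmf_affine[OF fin])
    also have "\<dots> \<le> p + ?b" using G[of s] by simp
    finally have "measure_pmf.prob (\<mu> t) {x. lam < U t x} \<le> p + ?b + real T * p"
      using pd[of s T] sum_le[of s T] unfolding t by linarith
    moreover have "?b \<le> ((1 - r) ^ T * B + 2 * (a / r)) / lam" using ar lam by (intro divide_right_mono) auto
    ultimately show ?thesis by (simp add: algebra_simps)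
  next
    \<comment> \<open>With fewer than \<open>T\<close> rounds the window begins at time 0, where
      \<open>U\<close> is at most \<open>a / r\<close>.\<close>
    case False
    let ?b = "(2 * (a / r)) / lam"
    have "measure_pmf.expectation (\<mu> 0) (\<lambda>x. min 1 (((1 - r) ^ t * U 0 x + (1 - (1 - r) ^ t) * (a / r)) / lam))
      \<le> measure_pmf.expectation (\<mu> 0) (\<lambda>x. ?b)"
    proof (rule expectation_pmf_mono[OF fin])
      fix x assume x: "x \<in> set_pmf (\<mu> 0)"
      have "(1 - r) ^ t * U 0 x \<le> 1 * (a / r)" using U0[OF x] pw U ar by (intro mult_mono) auto
      then have "((1 - r) ^ t * U 0 x + (1 - (1 - r) ^ t) * (a / r)) / lam \<le> ?b"
        using tail[of t] lam by (intro divide_right_mono) auto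
      then show "min 1 (((1 - r) ^ t * U 0 x + (1 - (1 - r) ^ t) * (a / r)) / lam) \<le> ?b" by linarith
    qed
    then have "measure_pmf.prob (\<mu> t) {x. lam < U t x} \<le> ?b + real t * p"
      using pd[of 0 t] sum_le[of 0 t] by simp
    moreover have "?b \<le> ((1 - r) ^ T * B + 2 * (a / r)) / lam" using pw B0 lam by (intro divide_right_mono) auto
    moreover have "real t * p \<le> (real T + 1) * p" using False p0 by (intro mult_right_mono) auto
    ultimately show ?thesis by linarith
  qed
qed

end

lemma prob_markov:
  fixes h :: "'a \<Rightarrow> real"
  assumes "finite (set_pmf M)" "\<And>x. x \<in> set_pmf M \<Longrightarrow> 0 \<le> h x" "0 < c"
  shows "measure_pmf.prob M {x. c \<le> h x} \<le> measure_pmf.expectation M h / c"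
proof -
  have "measure_pmf.expectation M (indicator {x. c \<le> h x}) \<le> measure_pmf.expectation M (\<lambda>x. 1 / c * h x + 0)"
    using assms by (intro expectation_pmf_mono) (auto simp: indicator_def)
  then show ?thesis unfolding expectation_pmf_affine[OF assms(1)] by simp
qed

subsection \<open>Tail bounds for the process\<close>

definition centered :: "nat \<Rightarrow> nat \<Rightarrow> (nat \<Rightarrow> nat) \<Rightarrow> nat \<Rightarrow> real" where
  "centered n t x i = real (x i) - real t / real n"

definition spread_le :: "nat \<Rightarrow> real \<Rightarrow> (nat \<Rightarrow> nat) \<Rightarrow> bool" where
  "spread_le n s x \<longleftrightarrow> (\<forall>i\<in>{1..n}. \<forall>j\<in>{1..n}. real (x i) - real (x j) \<le> s)"

lemma centered_diff: "centered n t x i - centered n t x j = real (x i) - real (x j)"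
  by (simp add: centered_def)

lemma centered_add_ball:
  "centered n (Suc t) (add_ball i x) = move {1..n} i (centered n t x)"
  by (auto simp: centered_def move_def add_ball_def add_divide_distrib)

lemma finite_set_step: "n \<ge> 1 \<Longrightarrow> finite (set_pmf (rel_threshold_step n c t x))"
  by (auto simp: rel_threshold_step_def)

lemma expectation_step:
  fixes h :: "(nat \<Rightarrow> nat) \<Rightarrow> real"
  assumes n: "n \<ge> 1"
  shows "measure_pmf.expectation (rel_threshold_step n c t x) h =
    (\<Sum>i\<in>{1..n}. bin_prob c {1..n} (centered n t x) i * h (add_ball i x))"
proof -
  let ?I = "{1..n}" and ?h = "\<lambda>i. h (add_ball i x)"
  let ?light = "\<lambda>i. centered n t x i < c"
  have I: "?I \<noteq> {}" "finite ?I" "card ?I = n" using n by auto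
  have light: "real (x i) < real t / real n + c \<longleftrightarrow> ?light i" for i
    by (auto simp: centered_def)
  have "measure_pmf.expectation (rel_threshold_step n c t x) h =
      (\<Sum>i1\<in>?I. (\<Sum>i2\<in>?I. (if ?light i1 then ?h i1 else ?h i2) / n) / n)"
    unfolding rel_threshold_step_def light
    using I by (simp add: pmf_expectation_bind_pmf_of_set divide_inverse mult.commute if_distrib[of "\<lambda>z. h z"])
  also have "\<dots> = (\<Sum>i\<in>?I. (if ?light i then ?h i / n else 0) + (if c \<le> centered n t x i then (\<Sum>j\<in>?I. ?h j) / n\<^sup>2 else 0))"
    using n by (intro sum.cong refl) (simp add: sum_divide_distrib[symmetric] power2_eq_square)
  also have "\<dots> = (\<Sum>i\<in>?I. if ?light i then ?h i / n else 0) + real (card {i \<in> ?I. c \<le> centered n t x i}) * ((\<Sum>j\<in>?I. ?h j) / n\<^sup>2)"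
    by (simp add: sum.distrib flip: sum.inter_filter)
  also have "\<dots> = (\<Sum>i\<in>?I. (if ?light i then ?h i / n else 0) + heavy_frac c ?I (centered n t x) / n * ?h i)"
    unfolding sum.distrib sum_distrib_left[symmetric] by (simp add: heavy_frac_def power2_eq_square)
  also have "\<dots> = (\<Sum>i\<in>?I. bin_prob c ?I (centered n t x) i * ?h i)"
    by (intro sum.cong refl) (simp add: bin_prob_def add_divide_distrib algebra_simps)
  finally show ?thesis .
qed

lemma finite_set_rel_threshold: "n \<ge> 1 \<Longrightarrow> finite (set_pmf (rel_threshold n c t))"
  by (induction t) (auto intro: finite_set_step)

lemma sum_rel_threshold:
  assumes "n \<ge> 1" "x \<in> set_pmf (rel_threshold n c t)"
  shows "(\<Sum>i\<in>{1..n}. x i) = t"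
  using assms(2)
proof (induction t arbitrary: x)
  case 0
  then show ?case by simp
next
  case (Suc t)
  then obtain z i where z: "z \<in> set_pmf (rel_threshold n c t)" and i: "i \<in> {1..n}" and x: "x = add_ball i z"
    using assms(1) by (auto simp: rel_threshold_step_def split: if_splits)
  have "(\<Sum>j\<in>{1..n}. x j) = (\<Sum>j\<in>{1..n}. z j + (if j = i then 1 else 0))"
    by (intro sum.cong refl) (simp add: x add_ball_def)
  also have "\<dots> = Suc t" using i Suc.IH[OF z] by (simp add: sum.distrib sum.delta)
  finally show ?case .
qed

lemma finite_chain_rel_threshold: "n \<ge> 1 \<Longrightarrow> finite_chain (rel_threshold n c) (rel_threshold_step n c)"
  by unfold_locales (auto intro: finite_set_rel_threshold)

lemma balanced_rel_threshold:
  assumes n: "n \<ge> 2" and x: "x \<in> set_pmf (rel_threshold n c t)" and c: "0 \<le> c"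
    and g: "0 < g" "g \<le> 1 / 2 ^ 46" "g * c \<le> 1 / 2 ^ 46"
  shows "balanced {1..n} (centered n t x) c g (real n)"
proof
  have "real (\<Sum>i\<in>{1..n}. x i) = real t" using sum_rel_threshold[OF _ x] n by simp
  then show "sum (centered n t x) {1..n} = 0"
    using n by (simp add: centered_def sum_subtractf)
qed (use n c g in auto)

text \<open>A centered load is the average of its differences to all loads.\<close>

lemma centered_le_spread:
  assumes n: "n \<ge> 1" and x: "x \<in> set_pmf (rel_threshold n c t)" and s: "spread_le n s x" and i: "i \<in> {1..n}"
  shows "centered n t x i \<le> s"
proof -
  have "real (\<Sum>i\<in>{1..n}. x i) = real t" using sum_rel_threshold[OF n x] by simp
  then have "(\<Sum>j\<in>{1..n}. centered n t x i - (real (x i) - real (x j))) = 0"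
    using n by (simp add: centered_def sum_subtractf)
  moreover have "(\<Sum>j\<in>{1..n}. centered n t x i - s) \<le> (\<Sum>j\<in>{1..n}. centered n t x i - (real (x i) - real (x j)))"
  proof (rule sum_mono)
    fix j assume "j \<in> {1..n}"
    then have "real (x i) - real (x j) \<le> s" using s i by (auto simp: spread_le_def)
    then show "centered n t x i - s \<le> centered n t x i - (real (x i) - real (x j))" by linarith
  qed
  ultimately show ?thesis using n by (simp add: mult_le_0_iff)
qed

lemma gap_le:
  assumes n: "n \<ge> 1" and b: "\<And>i. i \<in> {1..n} \<Longrightarrow> centered n t x i \<le> b"
  shows "gap n t x \<le> b"
proof -
  have "Max (x ` {1..n}) \<in> x ` {1..n}" using n by (intro Max_in) auto
  then obtain i where "i \<in> {1..n}" "Max (x ` {1..n}) = x i" by auto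
  then show ?thesis using b[of i] by (simp add: gap_def centered_def)
qed

locale process =
  fixes n :: nat and c g :: real
  assumes n_ge_2: "n \<ge> 2" and c_nonneg: "0 \<le> c" and g_range: "0 < g" "g \<le> 1 / 2 ^ 46" "g * c \<le> 1 / 2 ^ 46"
begin

abbreviation "I \<equiv> {1..n}"
abbreviation "\<mu> \<equiv> rel_threshold n c"
abbreviation "Y \<equiv> centered n"

sublocale finite_chain "rel_threshold n c" "rel_threshold_step n c"
  using n_ge_2 by (intro finite_chain_rel_threshold) simp

lemma balanced: "x \<in> set_pmf (\<mu> t) \<Longrightarrow> 0 < g' \<Longrightarrow> g' \<le> g \<Longrightarrow> balanced I (Y t x) c g' (real n)"
  using n_ge_2 c_nonneg g_range mult_right_mono[of g' g c] by (intro balanced_rel_threshold) auto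

lemma expectation_move:
  "measure_pmf.expectation (rel_threshold_step n c t x) (\<lambda>z. h (Y (Suc t) z)) =
    (\<Sum>i\<in>I. bin_prob c I (Y t x) i * h (move I i (Y t x)))" for h :: "(nat \<Rightarrow> real) \<Rightarrow> real"
  using n_ge_2 by (simp add: expectation_step centered_add_ball)

lemma potential_0: "0 < g' \<Longrightarrow> x \<in> set_pmf (\<mu> 0) \<Longrightarrow> potential g' I (Y 0 x) \<le> 1"
proof -
  assume g': "0 < g'" and "x \<in> set_pmf (\<mu> 0)"
  then have "Y 0 x = (\<lambda>_. 0)" by (auto simp: centered_def)
  then have "potential g' I (Y 0 x) = 1"
    using n_ge_2 by (simp add: potential_def pairpot_def expsum_def smoothing_def huber_def clamp1_def power2_eq_square g')
  then show ?thesis by simp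
qed

text \<open>Markov's inequality for the potential, whose mean is at most \<open>51 / g\<close>. The
  exponent is halved by the square in \<open>pairpot_le_potential\<close>.\<close>

lemma spread_tail:
  "measure_pmf.prob (\<mu> t) {x. x \<notin> {x. spread_le n s x}} \<le> 102 * real n / g * exp (- g * s / 2)"
proof -
  let ?X = "\<lambda>t x. potential g I (Y t x)"
  have g1: "1 \<le> 1 / g" "g \<le> 1" using g_range by (auto simp: field_simps)
  have E: "measure_pmf.expectation (\<mu> t) (?X t) \<le> 51 / g"
  proof (rule expectation_drift)
    fix t x assume x: "x \<in> set_pmf (\<mu> t)"
    interpret balanced I "Y t x" c g "real n" by (rule balanced[OF x]) (use g_range in auto)
    show "measure_pmf.expectation (rel_threshold_step n c t x) (?X (Suc t)) \<le> (1 - g\<^sup>2 / n) * ?X t x + 50 * g / n"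
      unfolding expectation_move by (rule potential_drift)
  next
    fix x assume "x \<in> set_pmf (\<mu> 0)"
    then have "?X 0 x \<le> 1" by (rule potential_0[OF g_range(1)])
    also have "\<dots> \<le> 51 / g" using g1 by simp
    finally show "?X 0 x \<le> 51 / g" .
  next
    have "g\<^sup>2 \<le> 1" using g_range g1 by (simp add: power_le_one)
    then show "g\<^sup>2 / n \<le> 1" using n_ge_2 by (simp add: divide_le_eq)
    show "50 * g / n / (g\<^sup>2 / n) \<le> 51 / g" using g_range n_ge_2 by (simp add: field_simps power2_eq_square)
  qed (use g_range n_ge_2 in auto)
  let ?l = "exp (g * s / 2) / (2 * real n)"
  have l: "0 < ?l" using n_ge_2 by simp
  have 1: "measure_pmf.prob (\<mu> t) {x. x \<notin> {x. spread_le n s x}} \<le> measure_pmf.prob (\<mu> t) {x. ?l \<le> ?X t x}"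
  proof (rule prob_pmf_mono[OF fin])
    fix x assume x: "x \<in> set_pmf (\<mu> t)" and "x \<in> {x. x \<notin> {x. spread_le n s x}}"
    then obtain i j where ij: "i \<in> I" "j \<in> I" "s < Y t x i - Y t x j"
      by (auto simp: spread_le_def centered_diff not_le)
    interpret balanced I "Y t x" c g "real n" by (rule balanced[OF x]) (use g_range in auto)
    have "(exp (g * s / 2))\<^sup>2 = exp (g * s)" by (simp add: power2_eq_square flip: exp_add)
    also have "\<dots> \<le> exp (g * (Y t x i - Y t x j))" using ij g_range by simp
    also have "\<dots> \<le> (real n)\<^sup>2 * pairpot g I (Y t x)" by (rule exp_diff_le_pairpot[OF ij(1,2)])
    also have "\<dots> \<le> (real n)\<^sup>2 * (2 * (?X t x)\<^sup>2)" by (intro mult_left_mono pairpot_le_potential) auto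
    also have "\<dots> \<le> (2 * real n * ?X t x)\<^sup>2" by (simp add: power_mult_distrib)
    finally have "(exp (g * s / 2))\<^sup>2 \<le> (2 * real n * ?X t x)\<^sup>2" .
    moreover have "0 \<le> 2 * real n * ?X t x" using less_imp_le[OF potential_pos] by simp
    ultimately have "exp (g * s / 2) \<le> 2 * real n * ?X t x" by (rule power2_le_imp_le)
    then have "?l \<le> ?X t x" using n_ge_2 by (simp add: divide_le_eq mult.commute)
    then show "x \<in> {x. ?l \<le> ?X t x}" by (simp only: mem_Collect_eq)
  qed
  have 2: "measure_pmf.prob (\<mu> t) {x. ?l \<le> ?X t x} \<le> measure_pmf.expectation (\<mu> t) (?X t) / ?l"
  proof (rule prob_markov[OF fin])
    fix x assume x: "x \<in> set_pmf (\<mu> t)"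
    interpret balanced I "Y t x" c g "real n" by (rule balanced[OF x]) (use g_range in auto)
    show "0 \<le> ?X t x" using potential_pos by simp
  qed (rule l)
  have 3: "measure_pmf.expectation (\<mu> t) (?X t) / ?l \<le> 51 / g / ?l"
    by (rule divide_right_mono[OF E less_imp_le[OF l]])
  have 4: "51 / g / ?l = 102 * real n / g * exp (- g * s / 2)"
  proof -
    have "- g * s / 2 = - (g * s / 2)" by simp
    then have e: "exp (- g * s / 2) = 1 / exp (g * s / 2)" by (simp only: exp_minus inverse_eq_divide)
    have r: "51 / g / (E / (2 * N)) = 102 * N / g * (1 / E)" for E N :: real by simp
    show ?thesis unfolding e by (rule r)
  qed
  show ?thesis by (rule order_trans[OF 1 order_trans[OF 2 3[unfolded 4]]])
qed

text \<open>The stationary size of the exponential moment is \<open>exp (25 * \<theta> + 1)\<close>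
  divided by the contraction rate. The level 50 leaves a factor of order
  \<open>exp (- 25 * \<theta>)\<close> to pay for that rate.\<close>

lemma potential_tail:
  assumes g': "0 < g'" "g' \<le> g" and p: "\<And>t. measure_pmf.prob (\<mu> t) {x. x \<notin> {x. spread_le n s x}} \<le> p"
    and \<theta>: "1 \<le> \<theta>" "200 * \<theta> * exp (3 * (g' * s)) \<le> n" and s: "0 \<le> s"
  shows "measure_pmf.prob (\<mu> t) {x. 50 < potential g' I (Y t x)} \<le>
    (real T + 1) * p + ((1 - g'\<^sup>2 / (2 * real n)) ^ T * exp (\<theta> * exp (g' * s))
      + 2 * (exp (25 * \<theta> + 1) / (g'\<^sup>2 / (2 * real n)))) / exp (50 * \<theta>)"
proof -
  let ?U = "\<lambda>t x. exp (\<theta> * potential g' I (Y t x))" and ?r = "g'\<^sup>2 / (2 * real n)"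
  have "g' \<le> 1" using g' g_range by simp
  then have "g'\<^sup>2 \<le> 1" using g' by (simp add: power_le_one)
  then have r: "0 < ?r" "?r \<le> 1" using g' n_ge_2 by (auto simp: divide_le_eq)
  have "measure_pmf.prob (\<mu> t) {x. exp (50 * \<theta>) < ?U t x} \<le> (real T + 1) * p
      + ((1 - ?r) ^ T * exp (\<theta> * exp (g' * s)) + 2 * (exp (25 * \<theta> + 1) / ?r)) / exp (50 * \<theta>)"
  proof (rule prob_drift_window[where U = ?U and G = "\<lambda>_. {x. spread_le n s x}"])
    fix t x assume x: "x \<in> set_pmf (\<mu> t)" and "x \<in> {x. spread_le n s x}"
    then have sp: "\<And>i j. i \<in> I \<Longrightarrow> j \<in> I \<Longrightarrow> Y t x i - Y t x j \<le> s"
      by (auto simp: centered_diff spread_le_def)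
    interpret balanced I "Y t x" c g' "real n" by (rule balanced[OF x g'])
    show "measure_pmf.expectation (rel_threshold_step n c t x) (?U (Suc t)) \<le> (1 - ?r) * ?U t x + exp (25 * \<theta> + 1)"
      unfolding expectation_move[where h = "\<lambda>y. exp (\<theta> * potential g' I y)"] by (rule exp_potential_drift[OF sp \<theta>])
    show "?U t x \<le> exp (\<theta> * exp (g' * s))"
      using order_trans[OF potential_le_pairpot pairpot_le_spread[OF sp]] \<theta> by simp
  next
    fix x assume "x \<in> set_pmf (\<mu> 0)"
    then have "\<theta> * potential g' I (Y 0 x) \<le> \<theta> * 1"
      using \<theta> by (intro mult_left_mono potential_0[OF g'(1)]) auto
    then have "\<theta> * potential g' I (Y 0 x) \<le> 25 * \<theta> + 1" using \<theta>(1) by linarith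
    then have "?U 0 x \<le> exp (25 * \<theta> + 1)" by (simp only: exp_le_cancel_iff)
    also have "\<dots> \<le> exp (25 * \<theta> + 1) / ?r"
    proof -
      have "exp (25 * \<theta> + 1) * ?r \<le> exp (25 * \<theta> + 1) * 1" using r by (intro mult_left_mono) auto
      then show ?thesis using r by (simp only: pos_le_divide_eq mult_1_right)
    qed
    finally show "?U 0 x \<le> exp (25 * \<theta> + 1) / ?r" .
  qed (use p r in auto)
  moreover have "exp (50 * \<theta>) < ?U t x \<longleftrightarrow> 50 < potential g' I (Y t x)" for x
    using \<theta> by (simp add: mult.commute[of 50])
  ultimately show ?thesis by simp
qed

lemma overload_tail:
  assumes a: "0 < a" "a \<le> \<epsilon> / 4" "\<epsilon> \<le> 1"
    and G: "\<And>t x. x \<in> set_pmf (\<mu> t) \<Longrightarrow> x \<in> G t \<Longrightarrow> \<epsilon> \<le> 1 - heavy_frac c I (Y t x)"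
    and Gs: "\<And>t x. x \<in> set_pmf (\<mu> t) \<Longrightarrow> x \<in> G t \<Longrightarrow> spread_le n s x"
    and p: "\<And>t. measure_pmf.prob (\<mu> t) {x. x \<notin> G t} \<le> p" and lam: "0 < lam"
  shows "measure_pmf.prob (\<mu> t) {x. lam < overload a c I (Y t x)} \<le>
    (real T + 1) * p + ((1 - a * \<epsilon> / (2 * real n)) ^ T * (n * exp (a * s)) + 8 * real n / \<epsilon>) / lam"
proof -
  let ?U = "\<lambda>t x. overload a c I (Y t x)" and ?r = "a * \<epsilon> / (2 * real n)"
  have e0: "0 < \<epsilon>" using a by linarith
  have "a * \<epsilon> \<le> 1 * 1" using a e0 by (intro mult_mono) auto
  then have r: "0 < ?r" "?r \<le> 1" using a e0 n_ge_2 by (auto simp: divide_le_eq)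
  have ar: "2 * a / ?r = 4 * real n / \<epsilon>" using a e0 n_ge_2 by (simp add: field_simps)
  have "measure_pmf.prob (\<mu> t) {x. lam < ?U t x} \<le> (real T + 1) * p
      + ((1 - ?r) ^ T * (n * exp (a * s)) + 2 * (2 * a / ?r)) / lam"
  proof (rule prob_drift_window[where U = ?U and G = G])
    fix t x assume x: "x \<in> set_pmf (\<mu> t)" and xG: "x \<in> G t"
    interpret balanced I "Y t x" c g "real n" by (rule balanced[OF x]) (use g_range in auto)
    show "measure_pmf.expectation (rel_threshold_step n c t x) (?U (Suc t)) \<le> (1 - ?r) * ?U t x + 2 * a"
      unfolding expectation_move[where h = "overload a c I"]
      by (intro overload_drift a) (unfold \<eta>_def \<delta>_def, rule G[OF x xG])
    have "?U t x \<le> (\<Sum>i\<in>I. exp (a * s))"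
      unfolding overload_def
    proof (rule sum_mono)
      fix i assume i: "i \<in> I"
      have "1 \<le> n" using n_ge_2 by simp
      then have "Y t x i \<le> s" by (rule centered_le_spread[OF _ x Gs[OF x xG] i])
      then have "Y t x i - c \<le> s" using c_nonneg by simp
      then show "exp (a * (Y t x i - c)) \<le> exp (a * s)" using a by simp
    qed
    then show "?U t x \<le> n * exp (a * s)" by simp
  next
    fix t x show "0 \<le> ?U t x" by (auto simp: overload_def intro: sum_nonneg)
  next
    fix x assume "x \<in> set_pmf (\<mu> 0)"
    then have "?U 0 x = n * exp (- a * c)" by (simp add: overload_def centered_def)
    also have "\<dots> \<le> real n * 1" using a c_nonneg by (intro mult_left_mono) auto
    also have "\<dots> \<le> 2 * a / ?r" 
    proof -
      have "\<epsilon> \<le> 4" using a(3) by simp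
      then have "real n * \<epsilon> \<le> real n * 4" by (rule mult_left_mono) simp
      then show ?thesis unfolding ar using e0 by (simp add: pos_le_divide_eq)
    qed
    finally show "?U 0 x \<le> 2 * a / ?r" .
  qed (use p r lam a in auto)
  then show ?thesis unfolding ar by simp
qed

lemma gap_le_overload:
  assumes a: "0 < a" and U: "overload a c I (Y t x) \<le> real n ^ k"
  shows "gap n t x \<le> c + k * ln n / a"
proof (rule gap_le)
  fix i assume i: "i \<in> I"
  have "exp (a * (Y t x i - c)) \<le> overload a c I (Y t x)"
    unfolding overload_def using i by (intro member_le_sum) auto
  also have "\<dots> \<le> exp (k * ln n)" using U n_ge_2 by (simp add: exp_of_nat_mult)
  finally show "Y t x i \<le> c + k * ln n / a" using a by (simp add: field_simps)
qed (use n_ge_2 in simp)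

end

subsection \<open>Choice of the parameters\<close>

text \<open>Both \<open>g\<close> and \<open>g * c\<close> stay below \<open>1 / 2 ^ 46\<close>, and
  \<open>g * c\<close> is at least half of that for \<open>c \<ge> 1\<close>.\<close>

definition base_rate :: "real \<Rightarrow> real" where
  "base_rate c = 1 / 2 ^ 46 / (1 + c)"

lemma process_base_rate: "n \<ge> 2 \<Longrightarrow> 0 \<le> c \<Longrightarrow> process n c (base_rate c)"
  unfolding base_rate_def by unfold_locales (auto simp: field_simps)

lemma prob_compl_le:
  assumes "measure_pmf.prob M {x. \<not> P x} \<le> q"
  shows "1 - q \<le> measure_pmf.prob M {x. P x}"
proof -
  have "{x. \<not> P x} = space (measure_pmf M) - {x. P x}" by auto
  then show ?thesis using measure_pmf.prob_compl[of "{x. P x}" M] assms by simp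
qed

lemma one_minus_power_le_exp:
  fixes r :: real
  assumes "r \<le> 1"
  shows "(1 - r) ^ T \<le> exp (- r * T)"
proof -
  have "(1 - r) ^ T \<le> exp (- r) ^ T" using assms exp_ge_add_one_self[of "- r"] by (intro power_mono) auto
  also have "\<dots> = exp (- r * T)" by (simp add: exp_of_nat_mult[symmetric] mult.commute)
  finally show ?thesis .
qed

text \<open>The exponential contributes \<open>1 / n ^ 25\<close>. Since
  \<open>c \<le> n\<^sup>2\<close>, the prefactor is at most \<open>102 * 2 ^ 47 * n ^ 3\<close>,
  and \<open>n \<ge> 2 ^ 27\<close> absorbs its constant into another \<open>n ^ 2\<close>.\<close>

lemma spread_tail_poly:
  assumes n: "n \<ge> 2 ^ 27" and c: "0 \<le> c" "c \<le> real n ^ 2"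
  shows "measure_pmf.prob (rel_threshold n c t) {x. x \<notin> {x. spread_le n (50 * ln n / base_rate c) x}} \<le> 1 / real n ^ 20"
proof -
  have n2: "n \<ge> 2" and rn: "real n \<ge> 2 ^ 27" using n by auto
  interpret process n c "base_rate c" by (rule process_base_rate[OF n2 c(1)])
  have np: "0 < real n" using n2 by simp
  have ig: "1 / base_rate c = 2 ^ 46 * (1 + c)" by (simp add: base_rate_def)
  have "exp (- base_rate c * (50 * ln n / base_rate c) / 2) = exp (- (25 * ln n))"
    using g_range by simp
  also have "\<dots> = inverse (exp (ln n) ^ 25)" by (simp add: exp_minus flip: exp_of_nat_mult)
  also have "\<dots> = 1 / real n ^ 25" using np by (simp add: divide_inverse)
  finally have e: "exp (- base_rate c * (50 * ln n / base_rate c) / 2) = 1 / real n ^ 25" .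
  have "102 * real n / base_rate c * (1 / real n ^ 25) = 102 * real n * (2 ^ 46 * (1 + c)) * (1 / real n ^ 25)"
    unfolding ig[symmetric] by simp
  also have "\<dots> \<le> 102 * real n * (2 ^ 46 * (2 * real n ^ 2)) * (1 / real n ^ 25)"
  proof (intro mult_right_mono mult_left_mono)
    have "1 \<le> real n ^ 2" using np n2 by (simp add: one_le_power)
    then show "1 + c \<le> 2 * real n ^ 2" using c by linarith
  qed (use np in auto)
  also have "\<dots> = (102 * 2 ^ 47) * (1 / real n ^ 22)" using np by (simp add: field_simps power_numeral_reduce)
  also have "\<dots> \<le> real n ^ 2 * (1 / real n ^ 22)"
  proof (rule mult_right_mono)
    have "(2 ^ 27) ^ 2 \<le> real n ^ 2" using rn by (intro power_mono) auto
    then show "102 * 2 ^ 47 \<le> real n ^ 2" by simp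
  qed auto
  also have "\<dots> = 1 / real n ^ 20" using np by (simp add: field_simps power_numeral_reduce)
  finally show ?thesis using spread_tail[of t "50 * ln n / base_rate c"] unfolding e by linarith
qed

text \<open>Division of the rate by 400 turns \<open>exp (g * s)\<close> into
  \<open>n powr (1/8)\<close>, so \<open>\<theta> = n powr (1/4)\<close> meets the step condition
  because \<open>1/4 + 3/8 < 1\<close>. The contraction rate is at least \<open>1 / n ^ 6\<close>,
  hence a window of \<open>n ^ 7\<close> rounds yields \<open>exp (- n)\<close> against the crude
  initial bound \<open>exp (n powr (3/8))\<close>.\<close>

lemma potential_tail_poly:
  assumes n: "n \<ge> 2 ^ 27" and c: "0 \<le> c" "c \<le> real n ^ 2"
    and E1: "200 * real n powr (1/4) * real n powr (3/8) \<le> n"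
    and E2: "1280000 * 2 ^ 92 \<le> real n"
    and E3: "exp (- real n + real n powr (1/4) * real n powr (1/8)) \<le> 1"
    and E4: "(1 + 2 * (exp (25 * real n powr (1/4) + 1) * real n ^ 6)) / exp (50 * real n powr (1/4)) \<le> 1 / real n ^ 13"
  shows "measure_pmf.prob (rel_threshold n c t) {x. 50 < potential (base_rate c / 400) {1..n} (centered n t x)} \<le> 3 / real n ^ 13"
proof -
  have n2: "n \<ge> 2" using n by auto
  interpret process n c "base_rate c" by (rule process_base_rate[OF n2 c(1)])
  have np: "1 < real n" using n2 by simp
  let ?s = "50 * ln n / base_rate c" and ?g = "base_rate c / 400" and ?\<theta> = "real n powr (1/4)"
  let ?r = "?g\<^sup>2 / (2 * real n)"
  have g': "0 < ?g" "?g \<le> base_rate c" using g_range by auto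
  have gs: "?g * ?s = ln n / 8" using g_range by simp
  have e3: "exp (3 * (?g * ?s)) = real n powr (3/8)" and e1: "exp (?g * ?s) = real n powr (1/8)"
    unfolding gs using np by (simp_all add: powr_def)
  have \<theta>: "1 \<le> ?\<theta>" using np by (simp add: ge_one_powr_ge_zero)
  have "1 / real n ^ 6 \<le> ?r"
  proof -
    have b: "base_rate c \<ge> 1 / 2 ^ 47 / real n ^ 2"
    proof -
      have "1 \<le> real n ^ 2" using np by (simp add: one_le_power)
      then have "1 + c \<le> 2 * real n ^ 2" using c by linarith
      then have "1 / 2 ^ 46 / (2 * real n ^ 2) \<le> 1 / 2 ^ 46 / (1 + c)" using c np by (intro divide_left_mono mult_pos_pos) auto
      then show ?thesis by (simp add: base_rate_def)
    qed
    have "(1 / 2 ^ 47 / real n ^ 2 / 400)\<^sup>2 \<le> ?g\<^sup>2" using b np by (intro power_mono divide_right_mono) auto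
    then have "(1 / 2 ^ 47 / real n ^ 2 / 400)\<^sup>2 / (2 * real n) \<le> ?r" using np by (intro divide_right_mono) auto
    moreover have "1 / real n ^ 6 \<le> (1 / 2 ^ 47 / real n ^ 2 / 400)\<^sup>2 / (2 * real n)"
    proof -
      have "(1 / 2 ^ 47 / real n ^ 2 / 400)\<^sup>2 / (2 * real n) = 1 / ((1280000 * 2 ^ 92) * real n ^ 5)"
        by (simp add: power_numeral_reduce power2_eq_square)
      moreover have "(1280000 * 2 ^ 92) * real n ^ 5 \<le> real n * real n ^ 5" using E2 by (intro mult_right_mono) auto
      moreover have "real n * real n ^ 5 = real n ^ 6" by (simp add: power_numeral_reduce)
      ultimately show ?thesis using np by (simp only:) (intro divide_left_mono, auto)
    qed
    ultimately show ?thesis by linarith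
  qed
  then have rT: "real n \<le> ?r * real (n ^ 7)"
    using mult_right_mono[of "1 / real n ^ 6" ?r "real n ^ 7"] np by (simp add: power_numeral_reduce field_simps)
  have r0: "0 < ?r" using g' np by simp
  have r1: "?r \<le> 1"
  proof -
    have "?g \<le> 1" using g_range by simp
    then have "?g\<^sup>2 \<le> 1" using g' by (intro power_le_one) auto
    then show ?thesis using np by (simp add: divide_le_eq)
  qed
  have "(1 - ?r) ^ (n ^ 7) * exp (?\<theta> * exp (?g * ?s)) \<le> exp (- ?r * real (n ^ 7)) * exp (?\<theta> * exp (?g * ?s))"
    by (intro mult_right_mono one_minus_power_le_exp r1) auto
  also have "\<dots> \<le> exp (- real n) * exp (?\<theta> * exp (?g * ?s))"
    using rT by (intro mult_right_mono) auto
  also have "\<dots> \<le> 1" using E3 unfolding e1 by (simp flip: exp_add)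
  finally have A: "(1 - ?r) ^ (n ^ 7) * exp (?\<theta> * exp (?g * ?s)) \<le> 1" .
  have "1 / ?r \<le> 1 / (1 / real n ^ 6)"
    by (rule divide_left_mono[OF \<open>1 / real n ^ 6 \<le> ?r\<close>]) (use r0 np in \<open>auto intro!: mult_pos_pos divide_pos_pos\<close>)
  then have "exp (25 * ?\<theta> + 1) * (1 / ?r) \<le> exp (25 * ?\<theta> + 1) * real n ^ 6"
    by (intro mult_left_mono) auto
  then have B: "exp (25 * ?\<theta> + 1) / ?r \<le> exp (25 * ?\<theta> + 1) * real n ^ 6" by simp
  have "((1 - ?r) ^ (n ^ 7) * exp (?\<theta> * exp (?g * ?s)) + 2 * (exp (25 * ?\<theta> + 1) / ?r)) / exp (50 * ?\<theta>)
    \<le> (1 + 2 * (exp (25 * ?\<theta> + 1) * real n ^ 6)) / exp (50 * ?\<theta>)"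
    using A B by (intro divide_right_mono add_mono mult_left_mono) auto
  also have "\<dots> \<le> 1 / real n ^ 13" by (rule E4)
  finally have C: "((1 - ?r) ^ (n ^ 7) * exp (?\<theta> * exp (?g * ?s)) + 2 * (exp (25 * ?\<theta> + 1) / ?r)) / exp (50 * ?\<theta>) \<le> 1 / real n ^ 13" .
  have "(real (n ^ 7) + 1) * (1 / real n ^ 20) \<le> (2 * real n ^ 7) * (1 / real n ^ 20)"
    using np by (intro mult_right_mono) (auto simp: one_le_power)
  also have "\<dots> = 2 / real n ^ 13" using np by (simp add: power_numeral_reduce)
  finally have D: "(real (n ^ 7) + 1) * (1 / real n ^ 20) \<le> 2 / real n ^ 13" .
  have "measure_pmf.prob (rel_threshold n c t) {x. 50 < potential ?g {1..n} (centered n t x)}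
    \<le> (real (n ^ 7) + 1) * (1 / real n ^ 20) + ((1 - ?r) ^ (n ^ 7) * exp (?\<theta> * exp (?g * ?s)) + 2 * (exp (25 * ?\<theta> + 1) / ?r)) / exp (50 * ?\<theta>)"
  proof (rule potential_tail[OF g' spread_tail_poly[OF n c] \<theta>])
    show "200 * ?\<theta> * exp (3 * (?g * ?s)) \<le> n" unfolding e3 by (rule E1)
    show "0 \<le> ?s" using g_range np by simp
  qed
  then show ?thesis using C D by (simp add: add_divide_distrib[symmetric])
qed

text \<open>A potential of at most 50 gives a pair potential of at most 5000, and
  \<open>g * c \<ge> 1 / (800 * 2 ^ 46)\<close>. The constant follows from
  \<open>light_frac_ge\<close> and \<open>800\<^sup>2 * 20000 \<le> 2 ^ 34\<close>.\<close>

lemma light_fraction: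
  assumes n: "n \<ge> 2" and c: "1 \<le> c" and x: "x \<in> set_pmf (rel_threshold n c t)"
    and X: "potential (base_rate c / 400) {1..n} (centered n t x) \<le> 50"
  shows "1 / 2 ^ 126 \<le> 1 - heavy_frac c {1..n} (centered n t x)"
proof -
  have c0: "0 \<le> c" using c by simp
  interpret process n c "base_rate c" by (rule process_base_rate[OF n c0])
  let ?g = "base_rate c / 400"
  have g': "0 < ?g" "?g \<le> base_rate c" using g_range by auto
  interpret b: balanced "{1..n}" "centered n t x" c ?g "real n" by (rule balanced[OF x g'])
  have "1 / 2 ^ 126 \<le> b.\<eta>"
  proof (cases "1/2 \<le> b.\<delta>")
    case False
    then show ?thesis using b.frac by simp
  next
    case True
    have "(potential ?g {1..n} (centered n t x))\<^sup>2 \<le> 50\<^sup>2"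
      using X less_imp_le[OF b.potential_pos] by (intro power_mono) auto
    then have P: "pairpot ?g {1..n} (centered n t x) \<le> 5000" using b.pairpot_le_potential by simp
    have "1 / 2 \<le> c / (1 + c)" using c by (simp add: pos_le_divide_eq)
    then have "1 / 2 ^ 46 / 400 * (1 / 2) \<le> 1 / 2 ^ 46 / 400 * (c / (1 + c))" by (intro mult_left_mono) auto
    also have "\<dots> = ?g * c" by (simp add: base_rate_def)
    finally have "(1 / 2 ^ 46 / 800)\<^sup>2 \<le> (?g * c)\<^sup>2" by (intro power_mono) auto
    also have "\<dots> \<le> 4 * b.\<eta> * pairpot ?g {1..n} (centered n t x)" by (rule b.light_frac_ge[OF True])
    also have "\<dots> \<le> 4 * b.\<eta> * 5000" using P b.frac by (intro mult_left_mono) auto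
    finally have "(1 / 2 ^ 46 / 800)\<^sup>2 / 20000 \<le> b.\<eta>" by simp
    moreover have "1 / 2 ^ 126 \<le> (1 / 2 ^ 46 / 800 :: real)\<^sup>2 / 20000" by (simp add: power2_eq_square)
    ultimately show ?thesis by linarith
  qed
  then show ?thesis unfolding b.\<eta>_def b.\<delta>_def .
qed

lemma gap_tail_small:
  assumes n: "n \<ge> 2 ^ 27" and c: "0 \<le> c" "c \<le> 1"
  shows "measure_pmf.prob (rel_threshold n c t) {x. \<not> gap n t x \<le> 2 ^ 132 * (ln n + c)} \<le> 1 / real n ^ 4"
proof -
  have n2: "n \<ge> 2" using n by auto
  interpret process n c "base_rate c" by (rule process_base_rate[OF n2 c(1)])
  have np: "1 \<le> real n" using n2 by simp
  then have n1: "1 \<le> n" by simp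
  have "1 \<le> real n ^ 2" using np by (simp add: one_le_power)
  then have cn: "c \<le> real n ^ 2" using c by linarith
  have ln0: "0 \<le> ln (real n)" using np by simp
  have "50 * ln n / base_rate c = 50 * ln n * (2 ^ 46 * (1 + c))" by (simp add: base_rate_def)
  also have "\<dots> \<le> 50 * ln n * (2 ^ 46 * 2)" using c ln0 by (intro mult_left_mono) auto
  also have "\<dots> \<le> 2 ^ 132 * ln n" using ln0 by simp
  also have "\<dots> \<le> 2 ^ 132 * (ln n + c)" using c by simp
  finally have s: "50 * ln n / base_rate c \<le> 2 ^ 132 * (ln n + c)" .
  have "measure_pmf.prob (rel_threshold n c t) {x. \<not> gap n t x \<le> 2 ^ 132 * (ln n + c)}
    \<le> measure_pmf.prob (rel_threshold n c t) {x. x \<notin> {x. spread_le n (50 * ln n / base_rate c) x}}"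
  proof (rule prob_pmf_mono[OF fin])
    fix x assume x: "x \<in> set_pmf (rel_threshold n c t)" and b: "x \<in> {x. \<not> gap n t x \<le> 2 ^ 132 * (ln n + c)}"
    show "x \<in> {x. x \<notin> {x. spread_le n (50 * ln n / base_rate c) x}}"
    proof (rule CollectI, rule notI)
      assume "x \<in> {x. spread_le n (50 * ln n / base_rate c) x}"
      then have "spread_le n (50 * ln n / base_rate c) x" by simp
      then have "gap n t x \<le> 50 * ln n / base_rate c"
        by (intro gap_le[OF n1] centered_le_spread[OF n1 x])
      then show False using b s by simp
    qed
  qed
  also have "\<dots> \<le> 1 / real n ^ 20" by (rule spread_tail_poly[OF n c(1) cn])
  also have "\<dots> \<le> 1 / real n ^ 4" using np by (intro divide_left_mono power_increasing) auto
  finally show ?thesis .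
qed

text \<open>The rate \<open>1 / 2 ^ 128\<close> is a quarter of the share from
  \<open>light_fraction\<close>. The spread may be of order \<open>n\<^sup>2 * ln n\<close>, but
  over \<open>n ^ 7\<close> rounds the overload contracts by \<open>exp (- n ^ 6 / 2 ^ 255)\<close>.
  Its stationary size is linear in \<open>n\<close>, so the level \<open>n ^ 7\<close> is rarely
  exceeded and costs only \<open>7 * 2 ^ 128 * ln n\<close> in the gap.\<close>

lemma gap_tail_middle:
  assumes n: "n \<ge> 2 ^ 27" and c: "1 \<le> c" "c \<le> real n ^ 2"
    and E1: "200 * real n powr (1/4) * real n powr (3/8) \<le> n"
    and E2: "1280000 * 2 ^ 92 \<le> real n"
    and E3: "exp (- real n + real n powr (1/4) * real n powr (1/8)) \<le> 1"
    and E4: "(1 + 2 * (exp (25 * real n powr (1/4) + 1) * real n ^ 6)) / exp (50 * real n powr (1/4)) \<le> 1 / real n ^ 13"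
    and E5: "exp (- (1 / 2 ^ 255) * real n ^ 6 + 1 / 2 ^ 128 * (50 * 2 ^ 47 * real n ^ 2 * ln n)) \<le> 1"
    and E6: "real n + 8 * 2 ^ 126 * real n \<le> real n ^ 2"
  shows "measure_pmf.prob (rel_threshold n c t) {x. \<not> gap n t x \<le> 2 ^ 132 * (ln n + c)} \<le> 1 / real n ^ 4"
proof -
  have n2: "n \<ge> 2" and rn: "real n \<ge> 2 ^ 27" using n by auto
  have c0: "0 \<le> c" using c by simp
  interpret process n c "base_rate c" by (rule process_base_rate[OF n2 c0])
  have np: "1 < real n" using n2 by simp
  have ln0: "0 \<le> ln (real n)" using np by simp
  let ?s = "50 * ln n / base_rate c" and ?a = "1 / 2 ^ 128 :: real" and ?\<epsilon> = "1 / 2 ^ 126 :: real"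
  let ?X = "\<lambda>t x. potential (base_rate c / 400) {1..n} (centered n t x)"
  let ?G = "\<lambda>t. {x. spread_le n ?s x \<and> ?X t x \<le> 50}"
  have p: "measure_pmf.prob (rel_threshold n c t) {x. x \<notin> ?G t} \<le> 4 / real n ^ 13" for t
  proof -
    have "measure_pmf.prob (rel_threshold n c t) {x. x \<notin> ?G t}
      \<le> measure_pmf.prob (rel_threshold n c t) ({x. x \<notin> {x. spread_le n ?s x}} \<union> {x. 50 < ?X t x})"
      by (rule prob_pmf_mono[OF fin]) auto
    also have "\<dots> \<le> measure_pmf.prob (rel_threshold n c t) {x. x \<notin> {x. spread_le n ?s x}} + measure_pmf.prob (rel_threshold n c t) {x. 50 < ?X t x}"
      by (rule measure_Un_le) auto
    also have "\<dots> \<le> 1 / real n ^ 20 + 3 / real n ^ 13"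
      by (intro add_mono spread_tail_poly potential_tail_poly assms c0)
    also have "1 / real n ^ 20 \<le> 1 / real n ^ 13" using np by (intro divide_left_mono power_increasing) auto
    finally show ?thesis by (simp add: add_divide_distrib[symmetric])
  qed
  let ?T = "n ^ 7" and ?r = "?a * ?\<epsilon> / (2 * real n)"
  have U: "measure_pmf.prob (rel_threshold n c t) {x. real n ^ 7 < overload ?a c {1..n} (centered n t x)} \<le>
      (real ?T + 1) * (4 / real n ^ 13) + ((1 - ?r) ^ ?T * (n * exp (?a * ?s)) + 8 * real n / ?\<epsilon>) / real n ^ 7"
  proof (rule overload_tail[where G = ?G])
    fix t x assume x: "x \<in> set_pmf (rel_threshold n c t)" and G: "x \<in> ?G t"
    show "?\<epsilon> \<le> 1 - heavy_frac c {1..n} (centered n t x)"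
      using G by (intro light_fraction[OF n2 c(1) x]) simp
    show "spread_le n ?s x" using G by simp
  qed (use p np in auto)
  have "(1 - ?r) ^ ?T * (n * exp (?a * ?s)) \<le> exp (- ?r * real ?T) * (n * exp (?a * ?s))"
    using np by (intro mult_right_mono one_minus_power_le_exp) (auto simp: divide_le_eq)
  also have "\<dots> = n * exp (- ?r * real ?T + ?a * ?s)" by (simp flip: exp_add)
  also have "\<dots> \<le> n * exp (- (1 / 2 ^ 255) * real n ^ 6 + ?a * (50 * 2 ^ 47 * real n ^ 2 * ln n))"
  proof -
    have "- ?r * real ?T = - (1 / 2 ^ 255) * real n ^ 6" using np by (simp add: power_numeral_reduce)
    moreover have "?s \<le> 50 * 2 ^ 47 * real n ^ 2 * ln n"
    proof -
      have "1 \<le> real n ^ 2" using np by (simp add: one_le_power)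
      then have "1 + c \<le> 2 * real n ^ 2" using c by linarith
      then have "50 * ln n * (2 ^ 46 * (1 + c)) \<le> 50 * ln n * (2 ^ 46 * (2 * real n ^ 2))" using ln0 by (intro mult_left_mono) auto
      then show ?thesis by (simp add: base_rate_def mult_ac)
    qed
    then have "?a * ?s \<le> ?a * (50 * 2 ^ 47 * real n ^ 2 * ln n)" by (intro mult_left_mono) auto
    ultimately show ?thesis by (intro mult_left_mono) auto
  qed
  also have "\<dots> \<le> real n * 1" using E5 by (intro mult_left_mono) auto
  finally have "(1 - ?r) ^ ?T * (n * exp (?a * ?s)) + 8 * real n / ?\<epsilon> \<le> real n ^ 2" using E6 by simp
  then have "((1 - ?r) ^ ?T * (n * exp (?a * ?s)) + 8 * real n / ?\<epsilon>) / real n ^ 7 \<le> real n ^ 2 / real n ^ 7"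
    by (intro divide_right_mono) auto
  also have "\<dots> = 1 / real n ^ 5" using np by (simp add: power_numeral_reduce)
  finally have A: "((1 - ?r) ^ ?T * (n * exp (?a * ?s)) + 8 * real n / ?\<epsilon>) / real n ^ 7 \<le> 1 / real n ^ 5" .
  have "(real ?T + 1) * (4 / real n ^ 13) \<le> (2 * real n ^ 7) * (4 / real n ^ 13)"
    using np by (intro mult_right_mono) (auto simp: one_le_power)
  also have "\<dots> = 8 / real n * (1 / real n ^ 5)" using np by (simp add: power_numeral_reduce)
  also have "\<dots> \<le> 1 * (1 / real n ^ 5)" using rn by (intro mult_right_mono) (auto simp: divide_le_eq)
  finally have B: "(real ?T + 1) * (4 / real n ^ 13) \<le> 1 / real n ^ 5" by simp
  have C: "2 * (1 / real n ^ 5) \<le> 1 / real n ^ 4"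
  proof -
    have "2 * (1 / real n ^ 5) = 2 / real n * (1 / real n ^ 4)" by (simp add: power_numeral_reduce)
    also have "\<dots> \<le> 1 * (1 / real n ^ 4)" using n2 by (intro mult_right_mono) (auto simp: divide_le_eq)
    finally show ?thesis by simp
  qed
  have "measure_pmf.prob (rel_threshold n c t) {x. \<not> gap n t x \<le> 2 ^ 132 * (ln n + c)}
    \<le> measure_pmf.prob (rel_threshold n c t) {x. real n ^ 7 < overload ?a c {1..n} (centered n t x)}"
  proof (rule prob_pmf_mono[OF fin])
    fix x assume b: "x \<in> {x. \<not> gap n t x \<le> 2 ^ 132 * (ln n + c)}"
    show "x \<in> {x. real n ^ 7 < overload ?a c {1..n} (centered n t x)}"
    proof (rule CollectI, rule ccontr)
      assume "\<not> real n ^ 7 < overload ?a c {1..n} (centered n t x)"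
      then have "gap n t x \<le> c + real 7 * ln n / ?a" by (intro gap_le_overload) auto
      also have "\<dots> \<le> 2 ^ 132 * (ln n + c)" using c0 ln0 by simp
      finally show False using b by simp
    qed
  qed
  then show ?thesis using U A B C by linarith
qed

text \<open>
  For so large an offset the rate \<open>1 / (4 * n)\<close> suffices, and at this rate the overload contracts
  in every configuration, because some bin is always below the threshold.
\<close>

lemma gap_tail_large:
  assumes n: "n \<ge> 5" and c: "real n ^ 2 \<le> c"
  shows "measure_pmf.prob (rel_threshold n c t) {x. \<not> gap n t x \<le> 2 ^ 132 * (ln n + c)} \<le> 1 / real n ^ 4"
proof -
  have n2: "n \<ge> 2" using n by auto
  have np: "5 \<le> real n" using n by simp
  have cp: "0 < c" using c np by (smt (verit) zero_less_power)
  interpret process n c "base_rate c" by (rule process_base_rate) (use n2 cp in auto)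
  have ln0: "0 \<le> ln (real n)" using np by simp
  \<comment> \<open>A single light bin gives the share \<open>1 / n\<close>, and
    \<open>overload_drift\<close> asks for a quarter of it.\<close>
  let ?a = "1 / (4 * real n)"
  let ?U = "\<lambda>t x. overload ?a c {1..n} (centered n t x)"
  have E: "measure_pmf.expectation (rel_threshold n c t) (?U t) \<le> 4 * real n ^ 2"
  proof (rule expectation_drift)
    fix t x assume x: "x \<in> set_pmf (rel_threshold n c t)"
    interpret b: balanced "{1..n}" "centered n t x" c "base_rate c" "real n" by (rule balanced[OF x]) (use g_range in auto)
    show "measure_pmf.expectation (rel_threshold_step n c t x) (?U (Suc t))
        \<le> (1 - ?a * (1 / real n) / (2 * real n)) * ?U t x + 2 * ?a"
      unfolding expectation_move[where h = "overload ?a c {1..n}"]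
      using np by (intro b.overload_drift b.light_frac_ge_inverse cp) auto
  next
    show "?a * (1 / real n) / (2 * real n) \<le> 1"
    proof -
      have "1 * (1 * 1) \<le> real n * (real n * real n)" using np by (intro mult_mono) auto
      then show ?thesis by (simp add: divide_le_eq)
    qed
    show "2 * ?a / (?a * (1 / real n) / (2 * real n)) \<le> 4 * real n ^ 2" using np by (simp add: field_simps power2_eq_square)
  next
    fix x assume "x \<in> set_pmf (rel_threshold n c 0)"
    then have "?U 0 x = real n * exp (- ?a * c)" by (simp add: overload_def centered_def)
    also have "\<dots> \<le> real n * 1" using cp by (intro mult_left_mono) auto
    also have "\<dots> \<le> 4 * real n ^ 2" using np by (simp add: power2_eq_square)
    finally show "?U 0 x \<le> 4 * real n ^ 2" .
  qed (use np in auto)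
  have "measure_pmf.prob (rel_threshold n c t) {x. \<not> gap n t x \<le> 2 ^ 132 * (ln n + c)}
    \<le> measure_pmf.prob (rel_threshold n c t) {x. real n ^ 7 \<le> ?U t x}"
  proof (rule prob_pmf_mono[OF fin])
    fix x assume b: "x \<in> {x. \<not> gap n t x \<le> 2 ^ 132 * (ln n + c)}"
    show "x \<in> {x. real n ^ 7 \<le> ?U t x}"
    proof (rule CollectI, rule ccontr)
      assume "\<not> real n ^ 7 \<le> ?U t x"
      then have "gap n t x \<le> c + real 7 * ln n / ?a" using np by (intro gap_le_overload) auto
      also have "\<dots> = c + 28 * (real n * ln n)" by simp
      \<comment> \<open>The loss \<open>28 * n * ln n\<close> caused by the small rate is absorbed
        by the offset.\<close>
      also have "real n * ln n \<le> real n * real n" using np ln_le_minus_one[of "real n"] by (intro mult_left_mono) auto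
      also have "real n * real n \<le> c" using c by (simp add: power2_eq_square)
      also have "c + 28 * c \<le> 2 ^ 132 * (ln n + c)" using cp ln0 by simp
      finally show False using b by simp
    qed
  qed
  also have "\<dots> \<le> measure_pmf.expectation (rel_threshold n c t) (?U t) / real n ^ 7"
    using np by (intro prob_markov fin) (auto simp: overload_def intro!: sum_nonneg)
  also have "\<dots> \<le> 4 * real n ^ 2 / real n ^ 7" using E by (intro divide_right_mono) auto
  also have "\<dots> = 4 / real n * (1 / real n ^ 4)" using np by (simp add: power_numeral_reduce)
  also have "\<dots> \<le> 1 * (1 / real n ^ 4)" using np by (intro mult_right_mono) (auto simp: divide_le_eq)
  finally show ?thesis by simp
qed

theorem theorem3p12:
  shows "\<exists>\<kappa>::real. \<kappa> > 0 \<and>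
    (\<forall>\<^sub>F n::nat in sequentially. \<forall>(m::nat) (f::nat \<Rightarrow> real). (\<forall>k. f k \<ge> 0) \<longrightarrow>
      measure_pmf.prob (rel_threshold n (f n) m)
        {x. gap n m x \<le> \<kappa> * (ln (real n) + f n)} \<ge> 1 - real n powi (-4))"
\<comment> \<open>The largest coefficient of \<open>ln n\<close> arises in the middle range, where
  it is \<open>7 * 2 ^ 128\<close>.\<close>
proof (intro exI[of _ "2 ^ 132"] conjI)
  have ev: "\<forall>\<^sub>F n::nat in sequentially. 200 * real n powr (1/4) * real n powr (3/8) \<le> n"
    "\<forall>\<^sub>F n::nat in sequentially. 1280000 * 2 ^ 92 \<le> real n"
    "\<forall>\<^sub>F n::nat in sequentially. exp (- real n + real n powr (1/4) * real n powr (1/8)) \<le> 1"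
    "\<forall>\<^sub>F n::nat in sequentially. (1 + 2 * (exp (25 * real n powr (1/4) + 1) * real n ^ 6)) / exp (50 * real n powr (1/4)) \<le> 1 / real n ^ 13"
    "\<forall>\<^sub>F n::nat in sequentially. exp (- (1 / 2 ^ 255) * real n ^ 6 + 1 / 2 ^ 128 * (50 * 2 ^ 47 * real n ^ 2 * ln n)) \<le> 1"
    "\<forall>\<^sub>F n::nat in sequentially. real n + 8 * 2 ^ 126 * real n \<le> real n ^ 2"
    by real_asymp+
  show "\<forall>\<^sub>F n::nat in sequentially. \<forall>(m::nat) (f::nat \<Rightarrow> real). (\<forall>k. f k \<ge> 0) \<longrightarrow>
      measure_pmf.prob (rel_threshold n (f n) m)
        {x. gap n m x \<le> 2 ^ 132 * (ln (real n) + f n)} \<ge> 1 - real n powi (-4)"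
    using ev eventually_ge_at_top[of "2 ^ 27"]
  proof eventually_elim
    case (elim n)
    show ?case
    proof (intro allI impI)
      fix m :: nat and f :: "nat \<Rightarrow> real" assume "\<forall>k. 0 \<le> f k"
      then have f: "0 \<le> f n" by simp
      have p: "real n powi (-4) = 1 / real n ^ 4" by (simp add: power_int_minus divide_inverse)
      have n5: "5 \<le> n" using elim(7) by simp
      consider "f n \<le> 1" | "1 \<le> f n" "f n \<le> real n ^ 2" | "real n ^ 2 \<le> f n" by linarith
      then have "measure_pmf.prob (rel_threshold n (f n) m) {x. \<not> gap n m x \<le> 2 ^ 132 * (ln n + f n)} \<le> 1 / real n ^ 4"
      proof cases
        case 1
        then show ?thesis by (rule gap_tail_small[OF elim(7) f])
      next
        case 2
        then show ?thesis by (rule gap_tail_middle[OF elim(7) _ _ elim(1-6)])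
      next
        case 3
        then show ?thesis by (rule gap_tail_large[OF n5])
      qed
      then show "1 - real n powi (-4) \<le> measure_pmf.prob (rel_threshold n (f n) m) {x. gap n m x \<le> 2 ^ 132 * (ln (real n) + f n)}"
        unfolding p by (rule prob_compl_le)
    qed
  qed
qed simp

end
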